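(* Let $s\in(\frac12,1)$ and $m>1$, and let $\mathcal I_{\rm sym}$ be a translation invariant, positively $1$-homogeneous nonlocal operator elliptic with respect to $\mathcal{K}_{\rm sym}$ (see context). Suppose that $u$ is a non-trivial viscosity solution to $$-\mathcal I_{\rm sym}u+|\nabla u|^m=0\quad\text{in }\mathbb{R}^n$$ that satisfies, for some constant $M$ and some $\gamma<2s$, $$|u(x)|\leq M(1+|x|)^\gamma\quad\text{for all }x\in\mathbb{R}^n,\qquad\text{and}\qquad \limsup_{|x|\to\infty}\frac{|u(x)|}{|x|^\gamma}>0.$$ Then $\gamma\leq\max\{0,\frac{m-2s}{m-1}\}$.
   Context: Fix $s\in(0,1)$ and $0<\lambda\leq\Lambda$. $\mathcal{K}_{\rm sym}=\mathcal{K}_{\rm sym}(\lambda,\Lambda)$ is the family of measurable kernels $K:\mathbb{R}^n\setminus\{0\}\to[0,\infty)$ with $\frac{\lambda}{|z|^{n+2s}}\leq K(z)\leq\frac{\Lambda}{|z|^{n+2s}}$ and $K(z)=K(-z)$ for $z\neq0$. With $B$ the unit ball centered at $0$, put $$L_Ku(x)=\int_{\mathbb{R}^n}\big[u(x+z)-u(x)-1_{\{2s\in[1,2)\}}1_B(z)\nabla u(x)\cdot z\big]K(z)\,dz .$$ Let $\omega_s(z)=(1+|z|)^{-n-2s}$, and let $L^1(\omega_s)$ be the functions integrable against $\omega_s$. $\mathcal I_{\rm sym}$ is a nonlocal operator which is translation invariant ($\mathcal I_{\rm sym}u_h(x)=\mathcal I_{\rm sym}u(x+h)$ for all $x,h$,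 where $u_h=u(\cdot+h)$), positively $1$-homogeneous, and elliptic with respect to $\mathcal{K}_{\rm sym}$, i.e. $$\inf_{K\in\mathcal{K}_{\rm sym}}(L_Ku(x)-L_Kv(x))\leq\mathcal I_{\rm sym}u(x)-\mathcal I_{\rm sym}v(x)\leq\sup_{K\in\mathcal{K}_{\rm sym}}(L_Ku(x)-L_Kv(x))$$ whenever $u,v\in C^{1,1}(x)\cap L^1(\omega_s)$ (where $C^{1,1}(x)$ means $C^{1,1}$ at the point $x$). Viscosity solutions: let $\Omega\subseteq\mathbb{R}^n$ be open and consider $-\mathcal I_{\rm sym}u+H(x,u,\nabla u)=0$ in $\Omega$, with $H$ continuous. A measurable $u\in L^1(\omega_s)$, upper (resp. lower) semicontinuous in $\bar\Omega$, is a viscosity subsolution (resp. supersolution) if for each $x_0\in\Omega$ and $\varphi\in C^2(B_r(x_0))$, for some $r>0$, with $u(x_0)=\varphi(x_0)$ and $u\leq\varphi$ (resp. $u\geq\varphi$) in $B_r(x_0)$, one has $-\mathcal I_{\rm sym}v(x_0)+H(x_0,u(x_0),\nabla\varphi(x_0))\leq0$ (resp. $\geq0$), where $v=\varphi$ in $B_r(x_0)$ and $v=u$ elsewhere. A viscosity solution is both a sub- and a supersolution. "Non-trivial" means not identically zero. *)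

theory Defs
  imports "HOL-Analysis.Analysis"
begin

text \<open>The space \<open>\<real>\<^sup>n\<close> is an arbitrary Euclidean space \<open>'a\<close> with \<open>n = DIM('a)\<close>. Measurability and
  integrals are taken with respect to the complete Lebesgue measure \<open>lebesgue\<close>.\<close>

definition grad :: "('a::euclidean_space \<Rightarrow> real) \<Rightarrow> 'a \<Rightarrow> 'a" where
  "grad u x = (THE D. GDERIV u x :> D)"

text \<open>A kernel is a total function here, but its value at the origin is never constrained and,
  \<open>{0}\<close> being a null set, never matters.\<close>

definition K_sym :: "real \<Rightarrow> real \<Rightarrow> real \<Rightarrow> ('a::euclidean_space \<Rightarrow> real) set" where
  "K_sym s lam Lam =
    {K. K \<in> borel_measurable lebesgue \<and>
        (\<forall>z. z \<noteq> 0 \<longrightarrow>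
           lam / norm z powr (real DIM('a) + 2 * s) \<le> K z \<and>
           K z \<le> Lam / norm z powr (real DIM('a) + 2 * s) \<and>
           K z = K (- z))}"

definition L_op ::
  "real \<Rightarrow> ('a::euclidean_space \<Rightarrow> real) \<Rightarrow> ('a \<Rightarrow> real) \<Rightarrow> 'a \<Rightarrow> real" where
  "L_op s K u x =
    (LINT z|lebesgue.
       (u (x + z) - u x
         - indicator {1..<2} (2 * s) * indicator (ball 0 1) z * (grad u x \<bullet> z)) * K z)"

definition weight :: "real \<Rightarrow> 'a::euclidean_space \<Rightarrow> real" where
  "weight s z = (1 + norm z) powr (- real DIM('a) - 2 * s)"

text \<open>As \<open>weight s\<close> is continuous and positive, integrability of the product includes Lebesgue
  measurability of \<open>u\<close>.\<close>

definition L1_weight :: "real \<Rightarrow> ('a::euclidean_space \<Rightarrow> real) set" where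
  "L1_weight s = {u. integrable lebesgue (\<lambda>z. u z * weight s z)}"

text \<open>Pointwise \<open>C\<^sup>1\<^sup>,\<^sup>1\<close> regularity: \<open>u\<close> agrees near \<open>x\<close> with an affine function up to a quadratic
  error. The vector \<open>D\<close> is then necessarily \<open>grad u x\<close>.\<close>

definition C11_at :: "'a::euclidean_space \<Rightarrow> ('a \<Rightarrow> real) set" where
  "C11_at x = {u. \<exists>D C r. r > 0 \<and>
     (\<forall>y\<in>ball x r. \<bar>u y - u x - D \<bullet> (y - x)\<bar> \<le> C * (norm (y - x))\<^sup>2)}"

text \<open>An operator \<open>I\<close> is represented by a total function; only its values \<open>I u x\<close> for
  \<open>u \<in> C11_at x \<inter> L1_weight s\<close> are meaningful, and every condition below refers to these only.\<close>

definition translation_invariant ::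
  "real \<Rightarrow> (('a::euclidean_space \<Rightarrow> real) \<Rightarrow> 'a \<Rightarrow> real) \<Rightarrow> bool" where
  "translation_invariant s I \<longleftrightarrow>
    (\<forall>u x h. u \<in> C11_at (x + h) \<inter> L1_weight s \<longrightarrow> I (\<lambda>y. u (y + h)) x = I u (x + h))"

definition positively_homogeneous ::
  "real \<Rightarrow> (('a::euclidean_space \<Rightarrow> real) \<Rightarrow> 'a \<Rightarrow> real) \<Rightarrow> bool" where
  "positively_homogeneous s I \<longleftrightarrow>
    (\<forall>u x t. u \<in> C11_at x \<inter> L1_weight s \<longrightarrow> t > 0 \<longrightarrow> I (\<lambda>y. t * u y) x = t * I u x)"

text \<open>For \<open>0 < s < 1\<close>, \<open>0 < lam \<le> Lam\<close> and admissible \<open>u\<close>, \<open>v\<close> the integrals defining \<open>L_op\<close> converge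
  absolutely, uniformly in the kernel, so the infimum and supremum below are those of a nonempty
  bounded set of reals.\<close>

definition elliptic ::
  "real \<Rightarrow> real \<Rightarrow> real \<Rightarrow> (('a::euclidean_space \<Rightarrow> real) \<Rightarrow> 'a \<Rightarrow> real) \<Rightarrow> bool" where
  "elliptic s lam Lam I \<longleftrightarrow>
    (\<forall>u v x. u \<in> C11_at x \<inter> L1_weight s \<longrightarrow> v \<in> C11_at x \<inter> L1_weight s \<longrightarrow>
       (INF K\<in>K_sym s lam Lam. L_op s K u x - L_op s K v x) \<le> I u x - I v x \<and>
       I u x - I v x \<le> (SUP K\<in>K_sym s lam Lam. L_op s K u x - L_op s K v x))"

definition upper_semicontinuous_on :: "'a::topological_space set \<Rightarrow> ('a \<Rightarrow> real) \<Rightarrow> bool" where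
  "upper_semicontinuous_on S u \<longleftrightarrow>
    (\<forall>x\<in>S. \<forall>a. u x < a \<longrightarrow> (\<forall>\<^sub>F y in at x within S. u y < a))"

definition lower_semicontinuous_on :: "'a::topological_space set \<Rightarrow> ('a \<Rightarrow> real) \<Rightarrow> bool" where
  "lower_semicontinuous_on S u \<longleftrightarrow>
    (\<forall>x\<in>S. \<forall>a. a < u x \<longrightarrow> (\<forall>\<^sub>F y in at x within S. a < u y))"

definition C2_on :: "'a::euclidean_space set \<Rightarrow> ('a \<Rightarrow> real) \<Rightarrow> bool" where
  "C2_on S \<phi> \<longleftrightarrow> (\<exists>(G :: 'a \<Rightarrow> 'a) (D :: 'a \<Rightarrow> 'a \<Rightarrow>\<^sub>L 'a).
     (\<forall>x\<in>S. GDERIV \<phi> x :> G x) \<and>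
     (\<forall>x\<in>S. (G has_derivative blinfun_apply (D x)) (at x)) \<and>
     continuous_on S D)"

text \<open>Viscosity sub- and supersolutions of \<open>- I u + H(x, u, \<nabla>u) = 0\<close> in an open set \<open>\<Omega>\<close>. A \<open>C\<^sup>2\<close>
  function on an open ball may blow up at its boundary; the requirement \<open>v \<in> L1_weight s\<close> on the
  glued function \<open>v\<close> restricts to test functions for which \<open>I v x0\<close> is meaningful.\<close>

definition viscosity_subsolution ::
  "real \<Rightarrow> (('a::euclidean_space \<Rightarrow> real) \<Rightarrow> 'a \<Rightarrow> real) \<Rightarrow> ('a \<Rightarrow> real \<Rightarrow> 'a \<Rightarrow> real) \<Rightarrow>
   'a set \<Rightarrow> ('a \<Rightarrow> real) \<Rightarrow> bool" where
  "viscosity_subsolution s I H \<Omega> u \<longleftrightarrow>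
    u \<in> L1_weight s \<and> upper_semicontinuous_on (closure \<Omega>) u \<and>
    (\<forall>x0\<in>\<Omega>. \<forall>r>0. \<forall>\<phi>.
       C2_on (ball x0 r) \<phi> \<longrightarrow> u x0 = \<phi> x0 \<longrightarrow> (\<forall>y\<in>ball x0 r. u y \<le> \<phi> y) \<longrightarrow>
       (let v = (\<lambda>y. if y \<in> ball x0 r then \<phi> y else u y)
        in v \<in> L1_weight s \<longrightarrow> - I v x0 + H x0 (u x0) (grad \<phi> x0) \<le> 0))"

definition viscosity_supersolution ::
  "real \<Rightarrow> (('a::euclidean_space \<Rightarrow> real) \<Rightarrow> 'a \<Rightarrow> real) \<Rightarrow> ('a \<Rightarrow> real \<Rightarrow> 'a \<Rightarrow> real) \<Rightarrow>
   'a set \<Rightarrow> ('a \<Rightarrow> real) \<Rightarrow> bool" where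
  "viscosity_supersolution s I H \<Omega> u \<longleftrightarrow>
    u \<in> L1_weight s \<and> lower_semicontinuous_on (closure \<Omega>) u \<and>
    (\<forall>x0\<in>\<Omega>. \<forall>r>0. \<forall>\<phi>.
       C2_on (ball x0 r) \<phi> \<longrightarrow> u x0 = \<phi> x0 \<longrightarrow> (\<forall>y\<in>ball x0 r. u y \<ge> \<phi> y) \<longrightarrow>
       (let v = (\<lambda>y. if y \<in> ball x0 r then \<phi> y else u y)
        in v \<in> L1_weight s \<longrightarrow> - I v x0 + H x0 (u x0) (grad \<phi> x0) \<ge> 0))"

definition viscosity_solution ::
  "real \<Rightarrow> (('a::euclidean_space \<Rightarrow> real) \<Rightarrow> 'a \<Rightarrow> real) \<Rightarrow> ('a \<Rightarrow> real \<Rightarrow> 'a \<Rightarrow> real) \<Rightarrow>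
   'a set \<Rightarrow> ('a \<Rightarrow> real) \<Rightarrow> bool" where
  "viscosity_solution s I H \<Omega> u \<longleftrightarrow>
    viscosity_subsolution s I H \<Omega> u \<and> viscosity_supersolution s I H \<Omega> u"

end

theory Submission
  imports Defs
begin

text \<open>Suppose \<open>\<gamma> > max 0 ((m - 2 * s) / (m - 1))\<close>. On scale \<open>R\<close>, where \<open>u\<close> is of size \<open>R\<^sup>\<gamma>\<close>, the gradient term
  then outweighs the diffusion by a positive power of \<open>R\<close>, so that \<open>u\<close> has to be flat to leading order.

  For an upper bound, touch the subsolution \<open>u\<close> from above by a barrier growing like \<open>\<epsilon> R\<^sup>\<gamma>\<close> around a centre \<open>c\<close>.
  At distance at least \<open>\<rho> = R\<^sup>k\<close> from \<open>c\<close> the contact is excluded by the gradient of the barrier. Within distance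
  \<open>\<rho>\<close> it is excluded by the nonlocal term as soon as the mean of \<open>max 0 (u - l)\<close> near \<open>c\<close> is small, where \<open>l\<close> is the
  base level of the barrier. Hence \<open>u \<le> l + o(R\<^sup>\<gamma>)\<close> on balls of radius comparable to \<open>R\<close>.

  With \<open>c = 0\<close> and \<open>l = 0\<close> this gives \<open>u \<le> o(R\<^sup>\<gamma>)\<close>. If \<open>u x \<le> - \<delta> R\<^sup>\<gamma>\<close> for some \<open>x\<close> with \<open>|x| = R\<close>, take for
  \<open>c\<close> a minimum point of \<open>u\<close> plus a small multiple of a growing function: the supersolution property at \<open>c\<close>
  bounds the mean of \<open>u - u c\<close> near \<open>c\<close>, so the barrier applies with \<open>l = - (\<delta> / 2) R\<^sup>\<gamma>\<close> and forces
  \<open>u 0 \<le> - (\<delta> / 4) R\<^sup>\<gamma>\<close>, which is impossible for large \<open>R\<close>.\<close>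

section \<open>Affine changes of variables and moments of the fractional kernel\<close>

text \<open>On scale \<open>R\<close> the gradient term has size
  \<open>R powr ((\<gamma> - 1) * m)\<close> and the diffusion
  \<open>R powr (\<gamma> - 2 * s)\<close>; the difference of exponents,
  \<open>\<gamma> * (m - 1) - m + 2 * s\<close>, is positive exactly above
  \<open>(m - 2 * s) / (m - 1)\<close>. The equation is not symmetric under \<open>u\<close> to
  \<open>- u\<close>: a steep test function contradicts touching from above, whereas touching from
  below only bounds the nonlocal term by the gradient. Hence the lower bound cannot mirror the upper
  one. A smooth radial barrier has a critical point at its centre, so there the only gain is the
  average gap between barrier and \<open>u\<close>, of order
  \<open>R powr \<gamma> * \<rho> powr (- 2 * s)\<close>. One regularized power of length
  \<open>R\<close> is too flat at distances much smaller than \<open>R\<close>; therefore a second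
  one, of length \<open>\<rho>\<close> and exponent \<open>a < \<gamma>\<close>, is added, and both
  have size \<open>\<epsilon> * R powr \<gamma>\<close> at distance \<open>R\<close>. The outer
  exponent \<open>b\<close> lies strictly between \<open>\<gamma>\<close> and \<open>2 * s\<close>:
  the barrier then outgrows \<open>u\<close> but stays integrable at infinity against the
  kernel.\<close>

lemma lebesgue_eq_density_affine:
  fixes t :: "'a::euclidean_space"
  assumes "c \<noteq> 0"
  shows "lebesgue = density (distr lebesgue lebesgue (\<lambda>x. t + c *\<^sub>R x)) (\<lambda>_. ennreal (\<bar>c\<bar> ^ DIM('a)))"
    and "(\<lambda>x. t + c *\<^sub>R x) \<in> lebesgue \<rightarrow>\<^sub>M lebesgue"
proof -
  have *: "t + (\<Sum>j\<in>Basis. (c * (x \<bullet> j)) *\<^sub>R j) = t + c *\<^sub>R x" for x :: 'a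
    unfolding scaleR_scaleR[symmetric] scaleR_sum_right[symmetric] euclidean_representation ..
  show "lebesgue = density (distr lebesgue lebesgue (\<lambda>x. t + c *\<^sub>R x)) (\<lambda>_. ennreal (\<bar>c\<bar> ^ DIM('a)))"
    using lebesgue_affine_euclidean[of "\<lambda>_::'a. c" t] assms unfolding * by simp
  show "(\<lambda>x. t + c *\<^sub>R x) \<in> lebesgue \<rightarrow>\<^sub>M lebesgue"
    using lebesgue_affine_measurable[of "\<lambda>_::'a. c" t] assms unfolding * by simp
qed

lemma integrable_lebesgue_affine:
  fixes f :: "'a::euclidean_space \<Rightarrow> real"
  assumes "integrable lebesgue f" "c \<noteq> 0"
  shows "integrable lebesgue (\<lambda>x. f (t + c *\<^sub>R x))"
proof -
  note [measurable] = lebesgue_eq_density_affine(2)[OF assms(2), of t]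
  have [measurable]: "f \<in> borel_measurable lebesgue" using assms(1) by simp
  have "integrable (density (distr lebesgue lebesgue (\<lambda>x. t + c *\<^sub>R x)) (\<lambda>_. ennreal (\<bar>c\<bar> ^ DIM('a)))) f"
    using assms(1) lebesgue_eq_density_affine(1)[OF assms(2), of t] by simp
  then have "integrable (distr lebesgue lebesgue (\<lambda>x. t + c *\<^sub>R x)) (\<lambda>x. \<bar>c\<bar> ^ DIM('a) * f x)"
    by (subst (asm) integrable_density) (auto simp: AE_I2)
  then have "integrable lebesgue (\<lambda>x. \<bar>c\<bar> ^ DIM('a) * f (t + c *\<^sub>R x))"
    by (subst (asm) integrable_distr_eq) auto
  then show ?thesis using assms(2) by (simp add: mult.commute)
qed

lemma integral_lebesgue_affine:
  fixes f :: "'a::euclidean_space \<Rightarrow> real"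
  assumes "f \<in> borel_measurable lebesgue" "c \<noteq> 0"
  shows "integral\<^sup>L lebesgue f = \<bar>c\<bar> ^ DIM('a) * (LINT x|lebesgue. f (t + c *\<^sub>R x))"
proof -
  note [measurable] = lebesgue_eq_density_affine(2)[OF assms(2), of t]
  note [measurable] = assms(1)
  have "integral\<^sup>L lebesgue f
      = integral\<^sup>L (density (distr lebesgue lebesgue (\<lambda>x. t + c *\<^sub>R x)) (\<lambda>_. ennreal (\<bar>c\<bar> ^ DIM('a)))) f"
    using lebesgue_eq_density_affine(1)[OF assms(2), of t] by simp
  also have "\<dots> = integral\<^sup>L (distr lebesgue lebesgue (\<lambda>x. t + c *\<^sub>R x)) (\<lambda>x. \<bar>c\<bar> ^ DIM('a) * f x)"
    by (subst integral_density) auto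
  also have "\<dots> = (LINT x|lebesgue. \<bar>c\<bar> ^ DIM('a) * f (t + c *\<^sub>R x))"
    by (subst integral_distr) auto
  finally show ?thesis by simp
qed

lemma integrable_lebesgue_shift:
  fixes f :: "'a::euclidean_space \<Rightarrow> real"
  assumes "integrable lebesgue f"
  shows "integrable lebesgue (\<lambda>x. f (t + x))"
  using integrable_lebesgue_affine[OF assms, of 1 t] by simp

lemma integral_lebesgue_shift:
  fixes f :: "'a::euclidean_space \<Rightarrow> real"
  assumes "f \<in> borel_measurable lebesgue"
  shows "(LINT x|lebesgue. f (t + x)) = integral\<^sup>L lebesgue f"
  using integral_lebesgue_affine[OF assms, of 1 t] by simp

lemma integrable_lebesgue_reflect:
  fixes f :: "'a::euclidean_space \<Rightarrow> real"
  assumes "integrable lebesgue f"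
  shows "integrable lebesgue (\<lambda>x. f (- x))"
  using integrable_lebesgue_affine[OF assms, of "-1" 0] by simp

lemma integral_lebesgue_reflect:
  fixes f :: "'a::euclidean_space \<Rightarrow> real"
  assumes "f \<in> borel_measurable lebesgue"
  shows "(LINT x|lebesgue. f (- x)) = integral\<^sup>L lebesgue f"
  using integral_lebesgue_affine[OF assms, of "-1" 0] by simp

text \<open>The functions \<open>c k * indicator (ball 0 (r k))\<close> add up to a majorant of
  \<open>\<bar>f\<bar>\<close> whose integral is a multiple of the series in \<open>sum\<close>.
  With dyadic radii this replaces polar coordinates.\<close>

lemma integrable_ball_cover:
  fixes f :: "'a::euclidean_space \<Rightarrow> real"
  assumes [measurable]: "f \<in> borel_measurable lebesgue"
    and c: "\<And>k::nat. 0 \<le> c k" and r: "\<And>k. 0 \<le> r k"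
    and cover: "\<And>z. f z \<noteq> 0 \<Longrightarrow> \<exists>k. z \<in> ball 0 (r k) \<and> \<bar>f z\<bar> \<le> c k"
    and sum: "summable (\<lambda>k. c k * r k ^ DIM('a))"
  shows "integrable lebesgue f"
proof (rule integrableI_bounded)
  let ?v = "measure lborel (ball (0::'a) 1)"
  have ball: "emeasure lebesgue (ball (0::'a) (r k)) = ennreal (r k ^ DIM('a) * ?v)" for k
    using content_ball_conv_unit_ball[OF r[of k], of "0::'a"]
    using emeasure_lborel_ball_finite[of "0::'a" "r k"]
    by (simp add: emeasure_eq_ennreal_measure)
  have "(\<integral>\<^sup>+z. norm (f z) \<partial>lebesgue)
      \<le> (\<integral>\<^sup>+z. (\<Sum>k. ennreal (c k) * indicator (ball (0::'a) (r k)) z) \<partial>lebesgue)"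
  proof (rule nn_integral_mono)
    fix z
    show "ennreal (norm (f z)) \<le> (\<Sum>k. ennreal (c k) * indicator (ball 0 (r k)) z)"
    proof (cases "f z = 0")
      case False
      then obtain k where k: "z \<in> ball 0 (r k)" "\<bar>f z\<bar> \<le> c k" using cover by blast
      have "ennreal (norm (f z)) \<le> (\<Sum>j\<in>{k}. ennreal (c j) * indicator (ball 0 (r j)) z)"
        using k by (simp add: ennreal_leI)
      also have "\<dots> \<le> (\<Sum>k. ennreal (c k) * indicator (ball 0 (r k)) z)"
        by (rule sum_le_suminf) auto
      finally show ?thesis .
    qed simp
  qed
  also have "\<dots> = (\<Sum>k. \<integral>\<^sup>+z. ennreal (c k) * indicator (ball (0::'a) (r k)) z \<partial>lebesgue)"
    by (intro nn_integral_suminf borel_measurable_times_ennreal borel_measurable_const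
        borel_measurable_indicator) simp
  also have "\<dots> = (\<Sum>k. ennreal (c k * r k ^ DIM('a) * ?v))"
    using c r by (simp add: nn_integral_cmult_indicator ball ennreal_mult[symmetric] mult.assoc)
  also have "\<dots> < \<infinity>"
    using c r sum by (auto simp: suminf_ennreal2 summable_mult2)
  finally show "(\<integral>\<^sup>+z. norm (f z) \<partial>lebesgue) < \<infinity>" .
qed simp

section \<open>The fractional kernel and its truncated moments\<close>

definition frac_kernel :: "real \<Rightarrow> 'a::euclidean_space \<Rightarrow> real" where
  "frac_kernel s z = norm z powr - (real DIM('a) + 2 * s)"

text \<open>Integrating the minimum at once controls second differences near the origin (exponent 2) and at
  infinity (exponent \<open>b\<close>), and scales like a power of the length.\<close>

definition moment_kernel :: "real \<Rightarrow> real \<Rightarrow> 'a::euclidean_space \<Rightarrow> real" where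
  "moment_kernel s b z = min ((norm z)\<^sup>2) (norm z powr b) * frac_kernel s z"

lemma frac_kernel_nonneg [simp]: "0 \<le> frac_kernel s z"
  by (simp add: frac_kernel_def)

lemma frac_kernel_zero [simp]: "frac_kernel s 0 = 0"
  by (simp add: frac_kernel_def)

lemma frac_kernel_minus [simp]: "frac_kernel s (- z) = frac_kernel s z"
  by (simp add: frac_kernel_def)

lemma frac_kernel_measurable [measurable]: "frac_kernel s \<in> borel_measurable lebesgue"
  unfolding frac_kernel_def[abs_def] by (rule measurable_completion) measurable

lemma frac_kernel_antimono:
  fixes z :: "'a::euclidean_space"
  assumes "0 < s" "0 < r" "r \<le> norm z"
  shows "frac_kernel s z \<le> r powr - (real DIM('a) + 2 * s)"
  unfolding frac_kernel_def using assms by (intro powr_mono2') auto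

lemma moment_kernel_nonneg [simp]: "0 \<le> moment_kernel s b z"
  by (simp add: moment_kernel_def)

lemma moment_kernel_measurable [measurable]: "moment_kernel s b \<in> borel_measurable lebesgue"
  unfolding moment_kernel_def[abs_def] frac_kernel_def[abs_def] by (rule measurable_completion) measurable

lemma dyadic_shell:
  fixes x :: real
  assumes "1 \<le> x"
  shows "\<exists>k::nat. 2 ^ k \<le> x \<and> x < 2 * 2 ^ k"
proof -
  define k where "k = nat \<lfloor>log 2 x\<rfloor>"
  have "0 \<le> log 2 x" using assms by simp
  then have "real k \<le> log 2 x" "log 2 x < real k + 1" unfolding k_def by linarith+
  then have "2 powr real k \<le> x" "x < 2 powr (real k + 1)"
    using assms by (auto simp: le_log_iff log_less_iff)
  then show ?thesis by (auto simp: powr_add powr_realpow mult.commute)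
qed

lemma summable_geometric_powr:
  assumes "e < 0"
  shows "summable (\<lambda>k::nat. (2 powr e) ^ k :: real)"
proof -
  have "2 powr e < 2 powr (0::real)" using assms by (intro powr_less_mono) auto
  then show ?thesis by (intro summable_geometric) simp
qed

text \<open>Dyadic shells contribute multiples of \<open>(2 powr (2 * s - 2)) ^ k\<close> inside the
  unit ball and of \<open>(2 powr (b - 2 * s)) ^ k\<close> outside: \<open>s < 1\<close> serves the
  origin, \<open>b < 2 * s\<close> serves infinity.\<close>

lemma integrable_moment_kernel:
  assumes "0 < s" "s < 1" "0 \<le> b" "b < 2 * s"
  shows "integrable lebesgue (moment_kernel s b :: 'a::euclidean_space \<Rightarrow> real)"
proof -
  let ?n = "real DIM('a)"
  let ?f = "\<lambda>z::'a. indicator (ball 0 1) z * moment_kernel s b z"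
  let ?g = "\<lambda>z::'a. indicator (- ball 0 1) z * moment_kernel s b z"
  have "integrable lebesgue ?f"
  proof (rule integrable_ball_cover)
    show "?f \<in> borel_measurable lebesgue"
      by (intro borel_measurable_times borel_measurable_indicator moment_kernel_measurable) auto
    show "\<exists>k. z \<in> ball 0 (2 * (1/2) ^ k) \<and> \<bar>?f z\<bar> \<le> ((1/2)^k)\<^sup>2 * ((1/2) * (1/2)^k) powr - (?n + 2 * s)"
      if "?f z \<noteq> 0" for z
    proof -
      from that have z: "norm z < 1" "z \<noteq> 0" by (auto simp: indicator_def moment_kernel_def split: if_splits)
      then obtain k where k: "2 ^ k \<le> 1 / norm z" "1 / norm z < 2 * 2 ^ k"
        using dyadic_shell[of "1 / norm z"] by auto
      then have z1: "norm z \<le> (1/2)^k" "(1/2) * (1/2)^k < norm z"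
        using z by (auto simp: field_simps power_divide)
      have "\<bar>?f z\<bar> \<le> (norm z)\<^sup>2 * frac_kernel s z"
        by (auto simp: indicator_def moment_kernel_def intro!: mult_right_mono)
      also have "\<dots> \<le> ((1/2)^k)\<^sup>2 * ((1/2) * (1/2)^k) powr - (?n + 2 * s)"
        using z1 assms by (intro mult_mono frac_kernel_antimono power_mono) auto
      moreover have "norm z < 2 * (1/2)^k"
        by (rule le_less_trans[OF z1(1)]) simp
      ultimately show ?thesis by (intro exI[of _ k]) auto
    qed
    have "(((1/2)^k)\<^sup>2 * ((1/2) * (1/2)^k) powr - (?n + 2 * s)) * (2 * (1/2)^k) ^ DIM('a)
        = (2 powr (?n + 2 * s) * 2 ^ DIM('a)) * (2 powr (2 * s - 2)) ^ k" for k :: nat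
    proof -
      have h: "(1/2::real)^k = 2 powr (- real k)"
        by (simp add: powr_minus powr_realpow power_one_over inverse_eq_divide)
      have p: "x\<^sup>2 = x powr 2" "x ^ DIM('a) = x powr ?n" if "0 < x" for x :: real
        using that by (simp_all add: powr_realpow)
      have "(((1/2)^k)\<^sup>2 * ((1/2) * (1/2)^k) powr - (?n + 2 * s)) * (2 * (1/2)^k) ^ DIM('a)
        = (2 powr (- real k)) powr 2 * (2 powr (-1) * 2 powr (- real k)) powr - (?n + 2 * s)
           * (2 powr 1 * 2 powr (- real k)) powr ?n"
        unfolding h by (subst p, simp)+ (simp add: powr_minus)
      also have "\<dots> = 2 powr (- real k * 2 + (- 1 - real k) * - (?n + 2 * s) + (1 - real k) * ?n)"
        unfolding powr_add[symmetric] powr_powr by (simp add: algebra_simps)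
      also have "\<dots> = 2 powr ((?n + 2 * s) + ?n + (2 * s - 2) * real k)"
        by (simp add: algebra_simps)
      also have "\<dots> = (2 powr (?n + 2 * s) * 2 ^ DIM('a)) * (2 powr (2 * s - 2)) ^ k"
        unfolding powr_add by (simp add: powr_realpow powr_powr[symmetric])
      finally show ?thesis .
    qed
    then show "summable (\<lambda>k::nat. (((1/2)^k)\<^sup>2 * ((1/2) * (1/2)^k) powr - (?n + 2 * s)) * (2 * (1/2)^k) ^ DIM('a))"
      using assms by (simp only:) (intro summable_mult summable_geometric_powr, simp)
  qed auto
  moreover have "integrable lebesgue ?g"
  proof (rule integrable_ball_cover)
    show "?g \<in> borel_measurable lebesgue"
      by (intro borel_measurable_times borel_measurable_indicator moment_kernel_measurable) auto
    show "\<exists>k. z \<in> ball 0 (2 * 2 ^ k) \<and> \<bar>?g z\<bar> \<le> (2 * 2^k) powr b * (2^k) powr - (?n + 2 * s)"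
      if "?g z \<noteq> 0" for z
    proof -
      from that have z: "norm z \<ge> 1" by (auto simp: indicator_def split: if_splits)
      then obtain k where k: "2 ^ k \<le> norm z" "norm z < 2 * 2 ^ k"
        using dyadic_shell[of "norm z"] by auto
      have "\<bar>?g z\<bar> \<le> norm z powr b * frac_kernel s z"
        by (auto simp: indicator_def moment_kernel_def intro!: mult_right_mono)
      also have "\<dots> \<le> (2 * 2^k) powr b * (2^k) powr - (?n + 2 * s)"
        using k assms by (intro mult_mono frac_kernel_antimono powr_mono2) auto
      finally show ?thesis using k by (intro exI[of _ k]) auto
    qed
    have "((2 * 2^k) powr b * (2^k) powr - (?n + 2 * s)) * (2 * 2^k) ^ DIM('a)
        = (2 powr b * 2 ^ DIM('a)) * (2 powr (b - 2 * s)) ^ k" for k :: nat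
    proof -
      have h: "(2::real)^k = 2 powr (real k)" by (simp add: powr_realpow)
      have "((2 * 2^k) powr b * (2^k) powr - (?n + 2 * s)) * (2 * 2^k) ^ DIM('a)
        = ((2 powr 1 * 2 powr real k) powr b * (2 powr real k) powr - (?n + 2 * s))
           * (2 powr 1 * 2 powr real k) powr ?n"
        unfolding h by (subst powr_realpow) simp_all
      also have "\<dots> = 2 powr ((1 + real k) * b + real k * - (?n + 2 * s) + (1 + real k) * ?n)"
        unfolding powr_add[symmetric] powr_powr by (simp add: algebra_simps)
      also have "\<dots> = 2 powr (b + ?n + (b - 2 * s) * real k)"
        by (simp add: algebra_simps)
      also have "\<dots> = (2 powr b * 2 ^ DIM('a)) * (2 powr (b - 2 * s)) ^ k"
        unfolding powr_add by (simp add: powr_realpow powr_powr[symmetric])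
      finally show ?thesis .
    qed
    then show "summable (\<lambda>k::nat. ((2 * 2^k) powr b * (2^k) powr - (?n + 2 * s)) * (2 * 2^k) ^ DIM('a))"
      using assms by (simp only:) (intro summable_mult summable_geometric_powr, simp)
  qed auto
  ultimately have "integrable lebesgue (\<lambda>z. ?f z + ?g z)" by (rule Bochner_Integration.integrable_add)
  moreover have "?f z + ?g z = moment_kernel s b z" for z by (auto simp: indicator_def)
  ultimately show ?thesis by simp
qed

text \<open>The type token carries the dimension, which the type of the value does not
  determine.\<close>

definition moment_mass :: "'a::euclidean_space itself \<Rightarrow> real \<Rightarrow> real \<Rightarrow> real" where
  "moment_mass T s b = integral\<^sup>L lebesgue (moment_kernel s b :: 'a \<Rightarrow> real)"

lemma moment_mass_nonneg: "0 \<le> moment_mass T s b"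
  unfolding moment_mass_def by (rule integral_nonneg_AE) simp

text \<open>Substituting \<open>w\<close> times the variable gives
  \<open>w powr - (n + 2 * s)\<close> by homogeneity of the kernel and \<open>w powr n\<close> from
  the volume, where \<open>n\<close> is the dimension.\<close>

lemma scaled_moment_kernel:
  fixes w :: real
  assumes "0 < s" "s < 1" "0 \<le> b" "b < 2 * s" "0 < w"
  defines "f \<equiv> \<lambda>z::'a::euclidean_space. min ((norm z / w)\<^sup>2) ((norm z / w) powr b) * frac_kernel s z"
  shows "integrable lebesgue f"
    and "integral\<^sup>L lebesgue f = w powr (- 2 * s) * moment_mass TYPE('a) s b"
proof -
  have f: "f z = w powr - (real DIM('a) + 2 * s) * moment_kernel s b (0 + (1 / w) *\<^sub>R z)" for z
  proof -
    have "frac_kernel s z = w powr - (real DIM('a) + 2 * s) * frac_kernel s ((1 / w) *\<^sub>R z)"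
      using assms by (simp add: frac_kernel_def powr_mult[symmetric])
    then show ?thesis using assms(5) unfolding f_def moment_kernel_def by simp
  qed
  have i: "integrable lebesgue (moment_kernel s b :: 'a \<Rightarrow> real)" by (rule integrable_moment_kernel) fact+
  show "integrable lebesgue f"
    unfolding f[abs_def] using assms(5)
    by (intro integrable_mult_right integrable_lebesgue_affine i) simp
  have "moment_mass TYPE('a) s b = (1 / w) ^ DIM('a) * (LINT z|lebesgue. moment_kernel s b (0 + (1 / w) *\<^sub>R z :: 'a))"
    unfolding moment_mass_def using assms(5) by (subst integral_lebesgue_affine[of _ "1 / w" 0]) auto
  then have "(LINT z|lebesgue. moment_kernel s b (0 + (1 / w) *\<^sub>R z :: 'a)) = w powr real DIM('a) * moment_mass TYPE('a) s b"
    using assms(5) by (simp add: powr_realpow power_divide)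
  then show "integral\<^sup>L lebesgue f = w powr (- 2 * s) * moment_mass TYPE('a) s b"
    unfolding f[abs_def] using assms(5) by (simp add: powr_add[symmetric])
qed

section \<open>Powers of the regularized norm\<close>

text \<open>A smooth substitute for the norm: of size \<open>t\<close> where
  \<open>norm x \<le> t\<close>, of size \<open>norm x\<close> beyond, and with smooth powers also
  at the origin.\<close>

definition rad :: "real \<Rightarrow> 'a::euclidean_space \<Rightarrow> real" where
  "rad t x = sqrt (t\<^sup>2 + (norm x)\<^sup>2)"

lemma rad_pos: "0 < t \<Longrightarrow> 0 < rad t x"
  unfolding rad_def by (simp add: add_pos_nonneg)

lemma rad_ge: "0 < t \<Longrightarrow> t \<le> rad t x" "norm x \<le> rad t x"
  unfolding rad_def by (auto intro!: real_le_rsqrt)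

lemma rad_le: "0 < t \<Longrightarrow> rad t x \<le> t + norm x"
  unfolding rad_def by (rule real_le_lsqrt) (auto simp: power2_sum)

lemma rad_sq: "(rad t x)\<^sup>2 = t\<^sup>2 + (norm x)\<^sup>2"
  unfolding rad_def by simp

lemma rad_powr: "0 < t \<Longrightarrow> rad t x powr b = (t\<^sup>2 + x \<bullet> x) powr (b / 2)"
  unfolding rad_def by (simp add: dot_square_norm powr_half_sqrt[symmetric] powr_powr)

lemma has_derivative_rad_powr:
  fixes c :: "'a::euclidean_space"
  assumes "0 < t"
  shows "((\<lambda>x. rad t (x - c) powr b) has_derivative
    (\<lambda>h. b * rad t (x - c) powr (b - 2) * (h \<bullet> (x - c)))) (at x within X)"
proof -
  let ?q = "t\<^sup>2 + (x - c) \<bullet> (x - c)"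
  have q: "0 < ?q" using assms by (simp add: add_pos_nonneg)
  have "?q powr (b / 2 - 1) = ?q powr (b / 2) / ?q"
    using q by (simp add: powr_diff)
  moreover have "((\<lambda>x. (t\<^sup>2 + (x - c) \<bullet> (x - c)) powr (b / 2)) has_derivative
     (\<lambda>h. ?q powr (b / 2) * (0 * ln ?q + (2 * (h \<bullet> (x - c))) * (b / 2) / ?q))) (at x)"
  proof (rule has_derivative_powr[where f = "\<lambda>x. b / 2" and g = "\<lambda>x. t\<^sup>2 + (x - c) \<bullet> (x - c)"])
    show "((\<lambda>x. t\<^sup>2 + (x - c) \<bullet> (x - c)) has_derivative (\<lambda>h. 2 * (h \<bullet> (x - c)))) (at x)"
      by (rule has_derivative_eq_rhs)
        (auto intro!: derivative_eq_intros simp: fun_eq_iff inner_commute algebra_simps)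
  qed (use q in \<open>auto intro!: derivative_eq_intros\<close>)
  moreover have "(\<lambda>h. ?q powr (b / 2) * (0 * ln ?q + (2 * (h \<bullet> (x - c))) * (b / 2) / ?q))
      = (\<lambda>h. b * (?q powr (b / 2) / ?q) * (h \<bullet> (x - c)))"
    by (simp add: fun_eq_iff)
  ultimately have "((\<lambda>x. (t\<^sup>2 + (x - c) \<bullet> (x - c)) powr (b / 2)) has_derivative
     (\<lambda>h. b * ?q powr (b / 2 - 1) * (h \<bullet> (x - c)))) (at x)"
    by simp
  then show ?thesis
    unfolding rad_powr[OF assms] by (auto simp: diff_divide_distrib intro: has_derivative_at_withinI)
qed

lemma GDERIV_rad_powr:
  fixes c :: "'a::euclidean_space"
  assumes "0 < t"
  shows "GDERIV (\<lambda>x. rad t (x - c) powr b) x :> (b * rad t (x - c) powr (b - 2)) *\<^sub>R (x - c)"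
  unfolding gderiv_def using has_derivative_rad_powr[OF assms] by simp

lemma continuous_on_rad_powr:
  assumes "0 < t"
  shows "continuous_on S (\<lambda>x. rad t (x - c) powr b)"
  using has_derivative_rad_powr[OF assms]
  by (intro has_derivative_continuous_on) blast

lemma C2_on_rad_powr:
  fixes c :: "'a::euclidean_space"
  assumes t: "0 < t"
  shows "C2_on S (\<lambda>x. rad t (x - c) powr b)"
proof -
  define F where "F x h = (b * rad t (x - c) powr (b - 2)) *\<^sub>R h
      + (b * (b - 2) * rad t (x - c) powr (b - 4) * (h \<bullet> (x - c))) *\<^sub>R (x - c)" for x h
  have F: "bounded_linear (F x)" for x
    unfolding F_def[abs_def]
    by (intro bounded_linear_intros bounded_linear_add bounded_linear_scaleR_const
        bounded_linear_const_mult bounded_linear_inner_left bounded_linear_scaleR_right)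
  define D where "D x = Blinfun (F x)" for x
  have D: "blinfun_apply (D x) = F x" for x
    unfolding D_def using F by (rule bounded_linear_Blinfun_apply)
  show ?thesis
    unfolding C2_on_def
  proof (intro exI conjI ballI)
    show "GDERIV (\<lambda>x. rad t (x - c) powr b) x :> (b * rad t (x - c) powr (b - 2)) *\<^sub>R (x - c)" for x
      by (rule GDERIV_rad_powr[OF t])
    show "((\<lambda>x. (b * rad t (x - c) powr (b - 2)) *\<^sub>R (x - c)) has_derivative blinfun_apply (D x)) (at x)" for x
      unfolding D F_def[abs_def]
      by (rule has_derivative_eq_rhs)
        (rule derivative_intros has_derivative_rad_powr[OF t] refl | simp add: fun_eq_iff algebra_simps)+
    show "continuous_on S D"
    proof (rule continuous_on_blinfun_componentwise)
      fix i :: 'a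
      show "continuous_on S (\<lambda>x. blinfun_apply (D x) i)"
        unfolding D F_def by (intro continuous_intros continuous_on_rad_powr[OF t])
    qed
  qed
qed

section \<open>Calculus of C^2 test functions\<close>

lemma C2_on_const: "C2_on S (\<lambda>x. k)"
  unfolding C2_on_def
  by (rule exI[of _ "\<lambda>x. 0"], rule exI[of _ "\<lambda>x. 0"]) (auto simp: GDERIV_const zero_blinfun.rep_eq)

lemma C2_on_add:
  assumes "C2_on S f" "C2_on S g"
  shows "C2_on S (\<lambda>x. f x + g x)"
proof -
  obtain Gf Df Gg Dg where *:
    "\<forall>x\<in>S. GDERIV f x :> Gf x" "\<forall>x\<in>S. (Gf has_derivative blinfun_apply (Df x)) (at x)" "continuous_on S Df"
    "\<forall>x\<in>S. GDERIV g x :> Gg x" "\<forall>x\<in>S. (Gg has_derivative blinfun_apply (Dg x)) (at x)" "continuous_on S Dg"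
    using assms unfolding C2_on_def by blast
  show ?thesis
    unfolding C2_on_def
    using * by (intro exI[of _ "\<lambda>x. Gf x + Gg x"] exI[of _ "\<lambda>x. Df x + Dg x"] conjI ballI)
      (auto intro!: GDERIV_add continuous_intros has_derivative_add simp: plus_blinfun.rep_eq)
qed

lemma C2_on_cmult:
  assumes "C2_on S f"
  shows "C2_on S (\<lambda>x. k * f x)"
proof -
  obtain Gf Df where *:
    "\<forall>x\<in>S. GDERIV f x :> Gf x" "\<forall>x\<in>S. (Gf has_derivative blinfun_apply (Df x)) (at x)" "continuous_on S Df"
    using assms unfolding C2_on_def by blast
  have "GDERIV (\<lambda>x. k * f x) x :> k *\<^sub>R Gf x" if "x \<in> S" for x
    using GDERIV_mult[OF GDERIV_const bspec[OF *(1) that], of k] by simp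
  with * show ?thesis
    unfolding C2_on_def
    by (intro exI[of _ "\<lambda>x. k *\<^sub>R Gf x"] exI[of _ "\<lambda>x. k *\<^sub>R Df x"] conjI ballI)
      (auto intro!: continuous_intros has_derivative_scaleR_right simp: scaleR_blinfun.rep_eq)
qed

lemma GDERIV_unique:
  assumes "GDERIV f x :> D" "GDERIV f x :> E"
  shows "D = E"
proof -
  have "(\<lambda>h. h \<bullet> D) = (\<lambda>h. h \<bullet> E)"
    using assms unfolding gderiv_def by (rule has_derivative_unique)
  then have "(D - E) \<bullet> D = (D - E) \<bullet> E" by metis
  then have "(D - E) \<bullet> (D - E) = 0" by (simp add: inner_diff_right)
  then show ?thesis by simp
qed

lemma grad_eqI: "GDERIV f x :> D \<Longrightarrow> grad f x = D"
  unfolding grad_def by (rule the_equality) (auto intro: GDERIV_unique)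

text \<open>Differentiability of the gradient at \<open>x\<close> bounds \<open>G z - G x\<close>
  linearly in the distance; the mean value inequality for \<open>\<phi>\<close> minus its linear
  part, on the ball of radius \<open>norm (y - x)\<close>, makes the error quadratic.\<close>

lemma C2_on_taylor:
  fixes \<phi> :: "'a::euclidean_space \<Rightarrow> real"
  assumes "C2_on (ball x r) \<phi>" "0 < r" "GDERIV \<phi> x :> D"
  obtains C d where "0 < d" "d \<le> r" "\<And>y. y \<in> ball x d \<Longrightarrow> \<bar>\<phi> y - \<phi> x - D \<bullet> (y - x)\<bar> \<le> C * (norm (y - x))\<^sup>2"
proof -
  obtain G D2 where G: "\<And>y. y \<in> ball x r \<Longrightarrow> GDERIV \<phi> y :> G y"
    and D2: "\<And>y. y \<in> ball x r \<Longrightarrow> (G has_derivative blinfun_apply (D2 y)) (at y)"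
    using assms(1) unfolding C2_on_def by blast
  have Gx: "G x = D" using GDERIV_unique[OF G assms(3)] assms(2) by simp
  have "(G has_derivative blinfun_apply (D2 x)) (at x)" using D2 assms by simp
  then obtain d0 where d0: "0 < d0"
    "\<And>y. norm (y - x) < d0 \<Longrightarrow> norm (G y - G x - D2 x (y - x)) \<le> 1 * norm (y - x)"
    unfolding has_derivative_at_alt by (metis zero_less_one)
  define d where "d = min d0 r"
  have lip: "norm (G y - G x) \<le> (1 + norm (D2 x)) * norm (y - x)" if "y \<in> ball x d" for y
  proof -
    have "norm (y - x) < d0" using that by (simp add: d_def dist_norm norm_minus_commute)
    then have "norm (G y - G x - D2 x (y - x)) \<le> norm (y - x)" using d0 by fastforce
    then have "norm (G y - G x) \<le> norm (y - x) + norm (D2 x (y - x))"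
      using norm_triangle_ineq[of "G y - G x - D2 x (y - x)" "D2 x (y - x)"] by simp
    also have "\<dots> \<le> norm (y - x) + norm (D2 x) * norm (y - x)"
      using norm_blinfun by simp
    finally show ?thesis by (simp add: algebra_simps)
  qed
  show thesis
  proof (rule that)
    show "0 < d" "d \<le> r" using d0 assms by (auto simp: d_def)
    fix y assume y: "y \<in> ball x d"
    let ?B = "cball x (norm (y - x))"
    have sub: "z \<in> ball x d" "z \<in> ball x r" if "z \<in> ?B" for z
      using that y by (auto simp: d_def dist_norm norm_minus_commute)
    have "norm ((\<phi> y - D \<bullet> y) - (\<phi> x - D \<bullet> x)) \<le> ((1 + norm (D2 x)) * norm (y - x)) * norm (y - x)"
    proof (rule differentiable_bound[where S = ?B])
      fix z assume z: "z \<in> ?B"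
      show "((\<lambda>y. \<phi> y - D \<bullet> y) has_derivative (\<lambda>h. h \<bullet> (G z - G x))) (at z within ?B)"
      proof -
        have "(\<phi> has_derivative (\<lambda>h. h \<bullet> G z)) (at z within ?B)"
          using G[OF sub(2)[OF z]] unfolding gderiv_def by (rule has_derivative_at_withinI)
        then have "((\<lambda>y. \<phi> y - D \<bullet> y) has_derivative (\<lambda>h. h \<bullet> G z - D \<bullet> h)) (at z within ?B)"
          by (auto intro!: derivative_eq_intros)
        then show ?thesis by (simp add: Gx inner_diff_right inner_commute)
      qed
      show "onorm (\<lambda>h. h \<bullet> (G z - G x)) \<le> (1 + norm (D2 x)) * norm (y - x)"
      proof (rule onorm_bound)
        fix h
        have "norm (h \<bullet> (G z - G x)) \<le> norm h * norm (G z - G x)"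
          by (simp add: Cauchy_Schwarz_ineq2)
        also have "\<dots> \<le> norm h * ((1 + norm (D2 x)) * norm (y - x))"
        proof (rule mult_left_mono)
          have "norm (z - x) \<le> norm (y - x)" using z by (simp add: dist_norm norm_minus_commute)
          then have "(1 + norm (D2 x)) * norm (z - x) \<le> (1 + norm (D2 x)) * norm (y - x)"
            by (intro mult_left_mono) auto
          then show "norm (G z - G x) \<le> (1 + norm (D2 x)) * norm (y - x)"
            using lip[OF sub(1)[OF z]] by linarith
        qed simp
        finally show "norm (h \<bullet> (G z - G x)) \<le> (1 + norm (D2 x)) * norm (y - x) * norm h"
          by (simp add: mult.commute)
      qed simp
    qed (auto simp: dist_norm norm_minus_commute)
    then show "\<bar>\<phi> y - \<phi> x - D \<bullet> (y - x)\<bar> \<le> (1 + norm (D2 x)) * (norm (y - x))\<^sup>2"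
      by (simp add: inner_diff_right power2_eq_square algebra_simps)
  qed
qed

text \<open>Concavity of the power, in the form of Young's inequality for
  \<open>q' powr p * q powr (1 - p)\<close>.\<close>

lemma powr_tangent:
  fixes q q' p :: real
  assumes "0 < q" "0 < q'" "0 \<le> p" "p \<le> 1"
  shows "q' powr p \<le> q powr p + p * q powr (p - 1) * (q' - q)"
proof -
  have "q' powr p * q powr (1 - p) \<le> p * q' + (1 - p) * q"
    using Youngs_inequality_0[of p "1 - p" q' q] assms by simp
  then have "q' powr p * q powr (1 - p) * q powr (p - 1) \<le> (p * q' + (1 - p) * q) * q powr (p - 1)"
    by (rule mult_right_mono) simp
  moreover have "q powr (1 - p) * q powr (p - 1) = 1"
    using assms by (simp add: powr_add[symmetric])
  moreover have "q * q powr (p - 1) = q powr p"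
    using assms by (simp add: powr_diff)
  ultimately show ?thesis
    by (simp add: algebra_simps mult.assoc)
qed

text \<open>As \<open>b \<le> 2\<close>, the function is a concave power of
  \<open>t\<^sup>2 + x \<bullet> x\<close>. Adding the tangent inequalities at \<open>x + z\<close>
  and \<open>x - z\<close> cancels the terms linear in \<open>z\<close> and leaves the quadratic
  bound. For \<open>norm z\<close> beyond \<open>rad t x\<close> each shifted value is at most
  \<open>4 * norm z powr b\<close>, whence the 8.\<close>

lemma rad_powr_second_difference:
  fixes x z :: "'a::euclidean_space"
  assumes t: "0 < t" and b: "0 \<le> b" "b \<le> 2"
  shows "rad t (x + z) powr b + rad t (x - z) powr b - 2 * rad t x powr b
    \<le> 8 * rad t x powr b * min ((norm z / rad t x)\<^sup>2) ((norm z / rad t x) powr b)"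
    (is "?L \<le> _")
proof -
  let ?w = "rad t x"
  let ?q = "\<lambda>y::'a. t\<^sup>2 + y \<bullet> y"
  have w: "0 < ?w" using rad_pos[OF t] .
  have q: "0 < ?q y" for y using t by (simp add: add_pos_nonneg)
  have "?L \<le> 2 * (b / 2 * ?q x powr (b / 2 - 1) * (z \<bullet> z))"
  proof -
    have "?q (x + z) - ?q x = 2 * (x \<bullet> z) + z \<bullet> z" "?q (x - z) - ?q x = z \<bullet> z - 2 * (x \<bullet> z)"
      by (simp_all add: inner_add_left inner_add_right inner_diff_left inner_diff_right inner_commute)
    then have "?q (x + z) powr (b / 2) \<le> ?q x powr (b / 2) + b / 2 * ?q x powr (b / 2 - 1) * (2 * (x \<bullet> z) + z \<bullet> z)"
      "?q (x - z) powr (b / 2) \<le> ?q x powr (b / 2) + b / 2 * ?q x powr (b / 2 - 1) * (z \<bullet> z - 2 * (x \<bullet> z))"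
      using powr_tangent[OF q[of x] q[of "x + z"], of "b / 2"]
        powr_tangent[OF q[of x] q[of "x - z"], of "b / 2"] b by simp_all
    then show ?thesis
      unfolding rad_powr[OF t] ring_distribs by linarith
  qed
  also have "\<dots> = b * rad t x powr (b - 2) * (z \<bullet> z)"
    unfolding rad_powr[OF t] by (simp add: diff_divide_distrib)
  also have "\<dots> = b * (rad t x powr b * (norm z / rad t x)\<^sup>2)"
    using w by (simp add: powr_diff dot_square_norm power_divide)
  also have "\<dots> \<le> 8 * (rad t x powr b * (norm z / rad t x)\<^sup>2)"
    using b by (intro mult_right_mono) auto
  finally have 1: "?L \<le> 8 * (rad t x powr b * (norm z / rad t x)\<^sup>2)" .
  show ?thesis
  proof (cases "norm z \<le> ?w")
    case True
    have "(norm z / ?w)\<^sup>2 \<le> (norm z / ?w) powr b"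
    proof (cases "z = 0")
      case False
      have "(norm z / ?w) powr 2 \<le> (norm z / ?w) powr b"
        using True w b False by (intro powr_mono') auto
      then show ?thesis using False w by simp
    qed simp
    then show ?thesis using 1 by (simp add: min_def)
  next
    case False
    have nz: "0 < norm z" using False w by linarith
    have e: "rad t y powr b \<le> 4 * norm z powr b" if "norm y \<le> norm x + norm z" for y
    proof -
      have "(norm y)\<^sup>2 \<le> (norm x + norm z)\<^sup>2" using that by (intro power_mono) auto
      also have "\<dots> \<le> 2 * (norm x)\<^sup>2 + 2 * (norm z)\<^sup>2"
        using sum_squares_bound[of "norm x" "norm z"] by (simp add: power2_sum)
      finally have "(rad t y)\<^sup>2 \<le> 2 * ?w\<^sup>2 + 2 * (norm z)\<^sup>2" by (simp add: rad_sq add_increasing)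
      also have "\<dots> \<le> (2 * norm z)\<^sup>2"
        using power_mono[of ?w "norm z" 2] False w by (simp add: power_mult_distrib)
      finally have "rad t y \<le> 2 * norm z" by (rule power2_le_imp_le) simp
      then have "rad t y powr b \<le> (2 * norm z) powr b"
        using rad_pos[OF t, of y] b by (intro powr_mono2) auto
      also have "\<dots> = 2 powr b * norm z powr b" by (simp add: powr_mult)
      also have "\<dots> \<le> 4 * norm z powr b"
        using powr_mono[of b 2 "2::real"] b by (intro mult_right_mono) auto
      finally show ?thesis .
    qed
    have "?L \<le> 8 * norm z powr b"
      using e[of "x + z"] e[of "x - z"] norm_triangle_ineq[of x z] norm_triangle_ineq4[of x z]
        powr_ge_zero[of ?w b] by linarith
    also have "\<dots> = 8 * (?w powr b * (norm z / ?w) powr b)"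
      using w by (simp add: powr_divide)
    finally show ?thesis using 1 by (simp add: min_def)
  qed
qed

section \<open>Second differences and linear operators\<close>

lemma L1_weight_measurable:
  fixes v :: "'a::euclidean_space \<Rightarrow> real"
  assumes "v \<in> L1_weight s"
  shows "v \<in> borel_measurable lebesgue"
proof -
  have w: "weight s \<in> borel_measurable (lebesgue :: 'a measure)"
    unfolding weight_def[abs_def] by (rule measurable_completion) measurable
  have "weight s z \<noteq> 0" for z :: 'a
    using norm_ge_zero[of z] add_pos_nonneg[of 1 "norm z"] unfolding weight_def by simp
  then have "v = (\<lambda>z. (v z * weight s z) / weight s z)" by simp
  moreover have "(\<lambda>z. (v z * weight s z) / weight s z) \<in> borel_measurable lebesgue"
    using assms w unfolding L1_weight_def by (intro borel_measurable_divide) auto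
  ultimately show ?thesis by simp
qed

lemma frac_kernel_eq: "frac_kernel s (z :: 'a::euclidean_space) = 1 / norm z powr (real DIM('a) + 2 * s)"
  unfolding frac_kernel_def powr_minus_divide ..

lemma K_sym_bounds:
  fixes K :: "'a::euclidean_space \<Rightarrow> real"
  assumes "K \<in> K_sym s lam Lam" "z \<noteq> 0"
  shows "lam * frac_kernel s z \<le> K z" "K z \<le> Lam * frac_kernel s z" "K (- z) = K z"
proof -
  have *: "lam / norm z powr (real DIM('a) + 2 * s) \<le> K z \<and>
      K z \<le> Lam / norm z powr (real DIM('a) + 2 * s) \<and> K z = K (- z)"
    using assms unfolding K_sym_def by blast
  show "lam * frac_kernel s z \<le> K z" "K z \<le> Lam * frac_kernel s z"
    unfolding frac_kernel_eq using * by simp_all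
  show "K (- z) = K z" using * by metis
qed

lemma K_sym_nonempty:
  fixes K :: "'a::euclidean_space \<Rightarrow> real"
  assumes "0 < lam" "lam \<le> Lam"
  shows "(\<lambda>z. lam * frac_kernel s z) \<in> (K_sym s lam Lam :: ('a \<Rightarrow> real) set)"
proof -
  have "(\<lambda>z::'a. lam * frac_kernel s z) \<in> borel_measurable lebesgue" by measurable
  moreover have "lam * frac_kernel s z \<le> Lam * frac_kernel s z" for z :: 'a
    using assms by (intro mult_right_mono) auto
  ultimately show ?thesis
    unfolding K_sym_def by (auto simp: frac_kernel_eq)
qed

text \<open>Away from its singularity the kernel is dominated by the translated weight, so
  membership in \<open>L1_weight s\<close> controls the tail of \<open>L_op\<close> at every point.
  The constant comes from \<open>1 + norm (x + z) \<le> (1 + norm x) + norm z\<close>, where the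
  bracket is absorbed by \<open>norm z \<ge> d\<close>.\<close>

lemma frac_kernel_le_weight:
  fixes x z :: "'a::euclidean_space"
  assumes "0 < s" "0 < d" "d \<le> norm z"
  shows "frac_kernel s z \<le> ((1 + norm x) / d + 1) powr (real DIM('a) + 2 * s) * weight s (x + z)"
proof -
  let ?c = "(1 + norm x) / d + 1" and ?N = "real DIM('a) + 2 * s"
  have nz: "0 < norm z" using assms by linarith
  have "1 + norm (x + z) \<le> (1 + norm x) + norm z" using norm_triangle_ineq[of x z] by simp
  also have "1 + norm x \<le> (1 + norm x) / d * norm z"
    using assms mult_left_mono[of d "norm z" "(1 + norm x) / d"] by simp
  finally have "1 + norm (x + z) \<le> ?c * norm z" by (simp add: algebra_simps)
  then have "(1 + norm (x + z)) powr ?N \<le> (?c * norm z) powr ?N"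
    using assms by (intro powr_mono2) auto
  also have "\<dots> = ?c powr ?N * norm z powr ?N"
    by (simp add: powr_mult)
  finally have "(1 + norm (x + z)) powr ?N \<le> ?c powr ?N * norm z powr ?N" .
  moreover have "0 < (1 + norm (x + z)) powr ?N" "0 < norm z powr ?N"
    using nz add_pos_nonneg[of 1 "norm (x + z)"] by simp_all
  moreover have "1 / b \<le> c * (1 / a)" if "a \<le> c * b" "0 < a" "0 < b" for a b c :: real
    using that by (simp add: field_simps)
  ultimately have "1 / norm z powr ?N \<le> ?c powr ?N * (1 / (1 + norm (x + z)) powr ?N)"
    by blast
  moreover have "weight s (x + z) = 1 / (1 + norm (x + z)) powr ?N"
    unfolding weight_def powr_minus_divide[symmetric] minus_add_distrib diff_conv_add_uminus ..
  ultimately show ?thesis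
    unfolding frac_kernel_eq by simp
qed

lemma integrable_L_op:
  fixes v :: "'a::euclidean_space \<Rightarrow> real"
  assumes s: "0 < s" "s < 1" and lam: "0 < lam"
    and K: "K \<in> K_sym s lam Lam"
    and v: "v \<in> L1_weight s"
    and r: "0 < r" "\<forall>y\<in>ball x r. \<bar>v y - v x - D \<bullet> (y - x)\<bar> \<le> C * (norm (y - x))\<^sup>2"
  shows "integrable lebesgue (\<lambda>z. (v (x + z) - v x - indicator (ball 0 1) z * (D \<bullet> z)) * K z)"
    (is "integrable _ ?F")
proof -
  \<comment> \<open>The bound \<open>d \<le> 1\<close> keeps the Taylor ball inside the unit ball,
    where the compensator is switched on.\<close>
  define d where "d = min r 1"
  have d: "0 < d" "d \<le> 1" "d \<le> r" using r by (auto simp: d_def)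
  let ?c = "((1 + norm x) / d + 1) powr (real DIM('a) + 2 * s)"
  \<comment> \<open>The first summand covers the Taylor regime; the second covers
    \<open>norm z \<ge> d\<close>, where \<open>min ((norm z)\<^sup>2) 1\<close> is at least
    \<open>d\<^sup>2\<close>.\<close>
  let ?A = "\<bar>C\<bar> + (\<bar>v x\<bar> + norm D) / d\<^sup>2"
  let ?G = "\<lambda>z. \<bar>Lam\<bar> * (?A * moment_kernel s 0 z + ?c * \<bar>v (x + z) * weight s (x + z)\<bar>)"
  have vm[measurable]: "v \<in> borel_measurable lebesgue" using v by (rule L1_weight_measurable)
  have vx: "(\<lambda>z. v (x + z)) \<in> borel_measurable lebesgue"
    using borel_measurable_affine[OF vm, of 1 x] by simp
  have Km: "K \<in> borel_measurable lebesgue" using K unfolding K_sym_def by auto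
  have Dm: "(\<lambda>z. D \<bullet> z) \<in> borel_measurable lebesgue"
    by (intro measurable_completion) measurable
  show ?thesis
  proof (rule Bochner_Integration.integrable_bound)
    have "integrable lebesgue (\<lambda>z. v (x + z) * weight s (x + z))"
      using integrable_lebesgue_shift[of "\<lambda>z. v z * weight s z" x] v unfolding L1_weight_def by simp
    moreover have "integrable lebesgue (moment_kernel s 0 :: 'a \<Rightarrow> real)"
      using s by (intro integrable_moment_kernel) auto
    ultimately show "integrable lebesgue ?G" by auto
    show "?F \<in> borel_measurable lebesgue"
      using vx Km Dm by (intro borel_measurable_times borel_measurable_diff borel_measurable_indicator) auto
    show "AE z in lebesgue. norm (?F z) \<le> norm (?G z)"
    proof (rule AE_I2)
      fix z :: 'a
      show "norm (?F z) \<le> norm (?G z)"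
      proof (cases "z = 0")
        case False
        have "0 \<le> lam * frac_kernel s z" using lam by simp
        then have Kz: "\<bar>K z\<bar> \<le> \<bar>Lam\<bar> * frac_kernel s z"
          using K_sym_bounds[OF K False] mult_right_mono[OF abs_ge_self[of Lam] frac_kernel_nonneg[of s z]]
          by linarith
        have w0: "0 \<le> ?c * \<bar>v (x + z) * weight s (x + z)\<bar>" by simp
        have t0: "moment_kernel s 0 z = min ((norm z)\<^sup>2) 1 * frac_kernel s z"
          using False by (simp add: moment_kernel_def)
        let ?f = "v (x + z) - v x - indicator (ball 0 1) z * (D \<bullet> z)"
        have "\<bar>?f\<bar> * frac_kernel s z \<le> ?A * moment_kernel s 0 z + ?c * \<bar>v (x + z) * weight s (x + z)\<bar>"
        proof (cases "norm z < d")
          case True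
          then have "z \<in> ball 0 1" "x + z \<in> ball x r" using d by (auto simp: dist_norm)
          then have "\<bar>?f\<bar> \<le> C * (norm z)\<^sup>2" using bspec[OF r(2), of "x + z"] by simp
          also have "\<dots> \<le> ?A * (norm z)\<^sup>2"
          proof (rule mult_right_mono)
            have "0 \<le> (\<bar>v x\<bar> + norm D) / d\<^sup>2" by simp
            then show "C \<le> ?A" by linarith
          qed simp
          finally have "\<bar>?f\<bar> * frac_kernel s z \<le> (?A * (norm z)\<^sup>2) * frac_kernel s z"
            by (rule mult_right_mono) simp
          moreover have "min ((norm z)\<^sup>2) 1 = (norm z)\<^sup>2"
            using True d power_mono[of "norm z" 1 2] by simp
          ultimately have "\<bar>?f\<bar> * frac_kernel s z \<le> ?A * moment_kernel s 0 z"
            unfolding t0 by (simp only: mult.assoc)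
          then show ?thesis using w0 by linarith
        next
          case False
          have "d\<^sup>2 \<le> (norm z)\<^sup>2" "d\<^sup>2 \<le> 1" using False d by (auto intro: power_mono power_le_one)
          then have "1 \<le> min ((norm z)\<^sup>2) 1 / d\<^sup>2" using d by simp
          then have "(\<bar>v x\<bar> + norm D) * 1 \<le> (\<bar>v x\<bar> + norm D) * (min ((norm z)\<^sup>2) 1 / d\<^sup>2)"
            by (intro mult_left_mono) auto
          also have "\<dots> \<le> ?A * min ((norm z)\<^sup>2) 1"
            by (simp add: distrib_right)
          finally have 1: "\<bar>v x\<bar> + norm D \<le> ?A * min ((norm z)\<^sup>2) 1" by simp
          have "\<bar>indicator (ball 0 1) z * (D \<bullet> z)\<bar> \<le> norm D"
            using Cauchy_Schwarz_ineq2[of D z] mult_left_le[of "norm z" "norm D"]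
            by (auto simp: indicator_def)
          then have "\<bar>?f\<bar> \<le> \<bar>v (x + z)\<bar> + (\<bar>v x\<bar> + norm D)" by linarith
          then have "\<bar>?f\<bar> * frac_kernel s z \<le> (\<bar>v (x + z)\<bar> + ?A * min ((norm z)\<^sup>2) 1) * frac_kernel s z"
            using 1 by (intro mult_right_mono) auto
          also have "\<dots> = \<bar>v (x + z)\<bar> * frac_kernel s z + ?A * moment_kernel s 0 z"
            unfolding t0 by (simp add: algebra_simps)
          also have "\<bar>v (x + z)\<bar> * frac_kernel s z \<le> \<bar>v (x + z)\<bar> * (?c * weight s (x + z))"
            using False d s by (intro mult_left_mono frac_kernel_le_weight) auto
          also have "\<dots> = ?c * \<bar>v (x + z) * weight s (x + z)\<bar>"
            by (simp add: abs_mult weight_def)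
          finally show ?thesis by linarith
        qed
        then have "\<bar>Lam\<bar> * (\<bar>?f\<bar> * frac_kernel s z) \<le> ?G z"
          by (intro mult_left_mono) auto
        moreover have "norm (?F z) \<le> \<bar>?f\<bar> * (\<bar>Lam\<bar> * frac_kernel s z)"
          using Kz by (simp add: abs_mult mult_left_mono)
        moreover have "?G z \<le> norm (?G z)" by simp
        ultimately show ?thesis by (simp add: mult.left_commute)
      qed simp
    qed
  qed
qed

text \<open>As the kernel is even, the compensator \<open>grad v x \<bullet> z\<close> cancels.\<close>

lemma L_op_second_difference:
  fixes v :: "'a::euclidean_space \<Rightarrow> real"
  assumes s: "1/2 < s" "s < 1" and lam: "0 < lam"
    and K: "K \<in> K_sym s lam Lam"
    and v: "v \<in> L1_weight s" and grad: "grad v x = D"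
    and r: "0 < r" "\<forall>y\<in>ball x r. \<bar>v y - v x - D \<bullet> (y - x)\<bar> \<le> C * (norm (y - x))\<^sup>2"
  shows "integrable lebesgue (\<lambda>z. (v (x + z) + v (x - z) - 2 * v x) * K z)"
    and "L_op s K v x = 1/2 * (LINT z|lebesgue. (v (x + z) + v (x - z) - 2 * v x) * K z)"
proof -
  let ?F = "\<lambda>z. (v (x + z) - v x - indicator (ball 0 1) z * (D \<bullet> z)) * K z"
  have F: "integrable lebesgue ?F"
    by (rule integrable_L_op[OF _ s(2) lam K v r]) (use s in linarith)
  have sum: "?F z + ?F (- z) = (v (x + z) + v (x - z) - 2 * v x) * K z" for z
  proof (cases "z = 0")
    case False
    then show ?thesis
      using K_sym_bounds(3)[OF K False] by (auto simp: indicator_def algebra_simps)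
  qed simp
  have "integrable lebesgue (\<lambda>z. ?F z + ?F (- z))"
    using F integrable_lebesgue_reflect[OF F] by (rule Bochner_Integration.integrable_add)
  then show "integrable lebesgue (\<lambda>z. (v (x + z) + v (x - z) - 2 * v x) * K z)"
    unfolding sum .
  have "(LINT z|lebesgue. (v (x + z) + v (x - z) - 2 * v x) * K z) = integral\<^sup>L lebesgue ?F + integral\<^sup>L lebesgue ?F"
    unfolding sum[symmetric]
    using F integrable_lebesgue_reflect[OF F] integral_lebesgue_reflect[of ?F] by simp
  moreover have "L_op s K v x = integral\<^sup>L lebesgue ?F"
    unfolding L_op_def grad using s by simp
  ultimately show "L_op s K v x = 1/2 * (LINT z|lebesgue. (v (x + z) + v (x - z) - 2 * v x) * K z)"
    by simp
qed

text \<open>Positive contributions \<open>p\<close> are charged at the upper kernel bound, deficits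
  \<open>q\<close> are credited at the lower one. The deficit is recorded one-sidedly:
  \<open>q z\<close> and \<open>q (- z)\<close> have the same integral, which cancels the factor 1/2
  of the symmetrization.\<close>

lemma L_op_le:
  fixes v :: "'a::euclidean_space \<Rightarrow> real"
  assumes s: "1/2 < s" "s < 1" and lam: "0 < lam"
    and K: "K \<in> K_sym s lam Lam"
    and v: "v \<in> L1_weight s" and grad: "grad v x = D"
    and r: "0 < r" "\<forall>y\<in>ball x r. \<bar>v y - v x - D \<bullet> (y - x)\<bar> \<le> C * (norm (y - x))\<^sup>2"
    and p: "\<And>z. 0 \<le> p z" "integrable lebesgue (\<lambda>z. p z * frac_kernel s z)"
    and q: "\<And>z. 0 \<le> q z" "integrable lebesgue (\<lambda>z. q z * frac_kernel s z)"
    and diff: "\<And>z. v (x + z) + v (x - z) - 2 * v x \<le> p z - q z - q (- z)"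
  shows "L_op s K v x \<le> Lam / 2 * (LINT z|lebesgue. p z * frac_kernel s z)
     - lam * (LINT z|lebesgue. q z * frac_kernel s z)"
proof -
  let ?P = "\<lambda>z. p z * frac_kernel s z" and ?Q = "\<lambda>z. q z * frac_kernel s z"
  have le: "(v (x + z) + v (x - z) - 2 * v x) * K z \<le> Lam * ?P z - lam * ?Q z - lam * ?Q (- z)" for z
  proof (cases "z = 0")
    case False
    note Kz = K_sym_bounds[OF K False]
    have "0 \<le> K z" using Kz(1) lam by (metis dual_order.trans frac_kernel_nonneg less_imp_le mult_nonneg_nonneg)
    then have "(v (x + z) + v (x - z) - 2 * v x) * K z \<le> (p z - q z - q (- z)) * K z"
      by (intro mult_right_mono diff)
    also have "\<dots> = p z * K z - q z * K z - q (- z) * K z" by (simp add: algebra_simps)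
    finally have 1: "(v (x + z) + v (x - z) - 2 * v x) * K z \<le> p z * K z - q z * K z - q (- z) * K z" .
    have "p z * K z \<le> p z * (Lam * frac_kernel s z)" using Kz(2) p(1) by (rule mult_left_mono)
    moreover have "q z * (lam * frac_kernel s z) \<le> q z * K z" using Kz(1) q(1) by (rule mult_left_mono)
    moreover have "q (- z) * (lam * frac_kernel s z) \<le> q (- z) * K z" using Kz(1) q(1) by (rule mult_left_mono)
    ultimately have "(v (x + z) + v (x - z) - 2 * v x) * K z
      \<le> p z * (Lam * frac_kernel s z) - q z * (lam * frac_kernel s z) - q (- z) * (lam * frac_kernel s z)"
      using 1 by linarith
    then show ?thesis by (simp add: mult.left_commute)
  qed simp
  have Q: "integrable lebesgue (\<lambda>z. ?Q (- z))" "(LINT z|lebesgue. ?Q (- z)) = integral\<^sup>L lebesgue ?Q"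
    using integrable_lebesgue_reflect[OF q(2)] integral_lebesgue_reflect[OF borel_measurable_integrable[OF q(2)]]
    by simp_all
  note sd = L_op_second_difference[OF s lam K v grad r]
  have "L_op s K v x = 1/2 * (LINT z|lebesgue. (v (x + z) + v (x - z) - 2 * v x) * K z)"
    by (rule sd(2))
  also have "\<dots> \<le> 1/2 * (LINT z|lebesgue. Lam * ?P z - lam * ?Q z - lam * ?Q (- z))"
    using le p(2) q(2) Q(1)
    by (intro mult_left_mono integral_mono sd(1) Bochner_Integration.integrable_diff integrable_mult_right) auto
  also have "(LINT z|lebesgue. Lam * ?P z - lam * ?Q z - lam * ?Q (- z))
      = Lam * integral\<^sup>L lebesgue ?P - lam * integral\<^sup>L lebesgue ?Q - lam * (LINT z|lebesgue. ?Q (- z))"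
    using p(2) q(2) Q(1) by simp
  finally show ?thesis unfolding Q(2) by (simp add: field_simps)
qed

section \<open>Test functions\<close>

text \<open>For a fixed kernel the second-difference formula is odd in \<open>v\<close>, so the
  upper bound for \<open>- v\<close> applies.\<close>

lemma L_op_ge:
  fixes v :: "'a::euclidean_space \<Rightarrow> real"
  assumes s: "1/2 < s" "s < 1" and lam: "0 < lam"
    and K: "K \<in> K_sym s lam Lam"
    and v: "v \<in> L1_weight s" and grad: "GDERIV v x :> D"
    and r: "0 < r" "\<forall>y\<in>ball x r. \<bar>v y - v x - D \<bullet> (y - x)\<bar> \<le> C * (norm (y - x))\<^sup>2"
    and p: "\<And>z. 0 \<le> p z" "integrable lebesgue (\<lambda>z. p z * frac_kernel s z)"
    and q: "\<And>z. 0 \<le> q z" "integrable lebesgue (\<lambda>z. q z * frac_kernel s z)"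
    and diff: "\<And>z. q z + q (- z) - p z \<le> v (x + z) + v (x - z) - 2 * v x"
  shows "lam * (LINT z|lebesgue. q z * frac_kernel s z)
     - Lam / 2 * (LINT z|lebesgue. p z * frac_kernel s z) \<le> L_op s K v x"
proof -
  have v': "(\<lambda>y. - v y) \<in> L1_weight s" using v by (simp add: L1_weight_def)
  have g: "grad v x = D" "grad (\<lambda>y. - v y) x = - D"
    using grad by (auto intro!: grad_eqI GDERIV_minus)
  have r': "\<forall>y\<in>ball x r. \<bar>- v y - - v x - (- D) \<bullet> (y - x)\<bar> \<le> C * (norm (y - x))\<^sup>2"
  proof
    fix y assume "y \<in> ball x r"
    then have "\<bar>v y - v x - D \<bullet> (y - x)\<bar> \<le> C * (norm (y - x))\<^sup>2" using r by blast
    then show "\<bar>- v y - - v x - (- D) \<bullet> (y - x)\<bar> \<le> C * (norm (y - x))\<^sup>2"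
      unfolding inner_minus_left by linarith
  qed
  have "L_op s K (\<lambda>y. - v y) x = 1/2 * (LINT z|lebesgue. - ((v (x + z) + v (x - z) - 2 * v x) * K z))"
    unfolding L_op_second_difference(2)[OF s lam K v' g(2) r(1) r']
    by (intro arg_cong2[where f = "(*)"] Bochner_Integration.integral_cong) (auto simp: algebra_simps)
  also have "\<dots> = - L_op s K v x"
    unfolding L_op_second_difference(2)[OF s lam K v g(1) r] by simp
  finally have "L_op s K (\<lambda>y. - v y) x = - L_op s K v x" .
  moreover have "L_op s K (\<lambda>y. - v y) x \<le> Lam / 2 * (LINT z|lebesgue. p z * frac_kernel s z)
     - lam * (LINT z|lebesgue. q z * frac_kernel s z)"
  proof (rule L_op_le[OF s lam K v' g(2) r(1) r' p q])
    show "- v (x + z) + - v (x - z) - 2 * - v x \<le> p z - q z - q (- z)" for z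
      using diff[of z] by linarith
  qed
  ultimately show ?thesis by linarith
qed

text \<open>Homogeneity gives \<open>I 0 = 2 * I 0\<close>, hence \<open>I 0 = 0\<close>, and
  ellipticity is applied to \<open>v\<close> against the zero function. Thus bounds uniform over the
  linear operators pass to the nonlinear one.\<close>

lemma elliptic_bounds:
  fixes I :: "('a::euclidean_space \<Rightarrow> real) \<Rightarrow> 'a \<Rightarrow> real"
  assumes ell: "elliptic s lam Lam I" and hom: "positively_homogeneous s I"
    and lam: "0 < lam" "lam \<le> Lam"
    and v: "v \<in> C11_at x" "v \<in> L1_weight s"
  shows "(\<And>K. K \<in> K_sym s lam Lam \<Longrightarrow> L_op s K v x \<le> B) \<Longrightarrow> I v x \<le> B"
    and "(\<And>K. K \<in> K_sym s lam Lam \<Longrightarrow> B \<le> L_op s K v x) \<Longrightarrow> B \<le> I v x"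
proof -
  have 0: "(\<lambda>_::'a. 0) \<in> C11_at x \<inter> L1_weight s"
    by (auto simp: C11_at_def L1_weight_def intro!: exI[of _ 0] exI[of _ 1])
  have "I (\<lambda>y. 2 * 0) x = 2 * I (\<lambda>y. 0) x"
    using hom[unfolded positively_homogeneous_def, rule_format, OF 0, of 2] by simp
  then have I0: "I (\<lambda>y. 0) x = 0" by simp
  have L0: "L_op s K (\<lambda>_. 0) x = 0" for K
    unfolding L_op_def grad_eqI[OF GDERIV_const] by simp
  have ne: "K_sym s lam Lam \<noteq> ({} :: ('a \<Rightarrow> real) set)"
    using K_sym_nonempty[OF lam] by blast
  have "(INF K\<in>K_sym s lam Lam. L_op s K v x) \<le> I v x" "I v x \<le> (SUP K\<in>K_sym s lam Lam. L_op s K v x)"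
    using ell[unfolded elliptic_def, rule_format, OF IntI[OF v] 0] by (simp_all add: L0 I0)
  then show "(\<And>K. K \<in> K_sym s lam Lam \<Longrightarrow> L_op s K v x \<le> B) \<Longrightarrow> I v x \<le> B"
    and "(\<And>K. K \<in> K_sym s lam Lam \<Longrightarrow> B \<le> L_op s K v x) \<Longrightarrow> B \<le> I v x"
    using order_trans[OF _ cSUP_least[OF ne]] order_trans[OF cINF_greatest[OF ne]] by metis+
qed

section \<open>Gluing test functions into \<open>u\<close>\<close>

lemma C2_on_subset: "C2_on T f \<Longrightarrow> S \<subseteq> T \<Longrightarrow> C2_on S f"
  unfolding C2_on_def by (meson continuous_on_subset subsetD)

lemma C2_on_imp_continuous_on:
  assumes "C2_on S f"
  shows "continuous_on S f"
proof -
  obtain G where "\<forall>x\<in>S. GDERIV f x :> G x" using assms unfolding C2_on_def by blast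
  then have "\<forall>x\<in>S. isCont f x"
    unfolding gderiv_def using has_derivative_continuous by blast
  then show ?thesis by (simp add: continuous_at_imp_continuous_on)
qed

text \<open>The function \<open>v\<close> of the viscosity definitions, as a function of the ball,
  the test function and \<open>u\<close>.\<close>

definition glue :: "'a::euclidean_space \<Rightarrow> real \<Rightarrow> ('a \<Rightarrow> real) \<Rightarrow> ('a \<Rightarrow> real) \<Rightarrow> 'a \<Rightarrow> real" where
  "glue x r \<phi> u y = (if y \<in> ball x r then \<phi> y else u y)"

lemma integrable_indicator_continuous:
  fixes f :: "'a::euclidean_space \<Rightarrow> real"
  assumes f: "continuous_on UNIV f" and S: "S \<in> sets lebesgue" "bounded S"
  shows "integrable lebesgue (\<lambda>y. indicator S y * f y)"
proof -
  obtain B where "\<And>x. x \<in> S \<Longrightarrow> norm x \<le> B"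
    using S(2) unfolding bounded_iff by blast
  then have B: "S \<subseteq> cball 0 B" by auto
  have "bounded (f ` cball 0 B)"
    by (intro compact_imp_bounded compact_continuous_image continuous_on_subset[OF f]) auto
  then obtain b where b: "\<And>y. y \<in> cball 0 B \<Longrightarrow> \<bar>f y\<bar> \<le> b"
    unfolding bounded_iff by (metis image_eqI real_norm_def)
  have "f \<in> borel_measurable borel" using f by (rule borel_measurable_continuous_onI)
  then have m: "f \<in> borel_measurable lebesgue" by (intro measurable_completion) simp
  have "integrable lebesgue (\<lambda>y. indicator S y *\<^sub>R f y)"
  proof (rule integrableI_bounded_set_indicator[where B = b])
    have "emeasure lebesgue S \<le> emeasure lebesgue (cball (0::'a) B)"
      using B by (intro emeasure_mono) auto
    also have "\<dots> < \<infinity>" using emeasure_lborel_cball_finite[of "0::'a" B] by simp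
    finally show "emeasure lebesgue S < \<infinity>" .
  qed (use m b B S in \<open>auto intro!: AE_I2\<close>)
  then show ?thesis by simp
qed

lemma glue_L1_weight:
  fixes u :: "'a::euclidean_space \<Rightarrow> real"
  assumes u: "u \<in> L1_weight s" and \<phi>: "continuous_on UNIV \<phi>"
  shows "glue x r \<phi> u \<in> L1_weight s"
proof -
  have w: "continuous_on UNIV (weight s :: 'a \<Rightarrow> real)"
    unfolding weight_def[abs_def]
    by (intro continuous_intros) (metis add_pos_nonneg less_irrefl norm_ge_zero zero_less_one)
  have "integrable lebesgue (\<lambda>y. indicator (ball x r) y * (\<phi> y * weight s y))"
    by (intro integrable_indicator_continuous continuous_intros \<phi> w) auto
  moreover have "integrable lebesgue (\<lambda>y. indicator (- ball x r) y *\<^sub>R (u y * weight s y))"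
    using u unfolding L1_weight_def by (intro integrable_mult_indicator) auto
  ultimately have "integrable lebesgue (\<lambda>y. indicator (ball x r) y * (\<phi> y * weight s y)
      + indicator (- ball x r) y *\<^sub>R (u y * weight s y))"
    by (rule Bochner_Integration.integrable_add)
  moreover have "indicator (ball x r) y * (\<phi> y * weight s y)
      + indicator (- ball x r) y *\<^sub>R (u y * weight s y) = glue x r \<phi> u y * weight s y" for y
    by (simp add: glue_def indicator_def)
  ultimately show ?thesis unfolding L1_weight_def by simp
qed

lemma glue_regular:
  fixes u :: "'a::euclidean_space \<Rightarrow> real"
  assumes \<phi>: "C2_on UNIV \<phi>" and D: "GDERIV \<phi> x :> D" and r: "0 < r"
  shows "GDERIV (glue x r \<phi> u) x :> D"
    and "\<exists>C d. 0 < d \<and> (\<forall>y\<in>ball x d. \<bar>glue x r \<phi> u y - glue x r \<phi> u x - D \<bullet> (y - x)\<bar> \<le> C * (norm (y - x))\<^sup>2)"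
proof -
  show "GDERIV (glue x r \<phi> u) x :> D"
    unfolding gderiv_def
    using r by (intro has_derivative_transform_within_open[OF D[unfolded gderiv_def], of "ball x r"])
      (auto simp: glue_def)
  have "C2_on (ball x r) \<phi>" using \<phi> by (rule C2_on_subset) simp
  from C2_on_taylor[OF this r D] obtain C d where Cd: "0 < d" "d \<le> r"
    "\<And>y. y \<in> ball x d \<Longrightarrow> \<bar>\<phi> y - \<phi> x - D \<bullet> (y - x)\<bar> \<le> C * (norm (y - x))\<^sup>2" by metis
  then have "\<forall>y\<in>ball x d. \<bar>glue x r \<phi> u y - glue x r \<phi> u x - D \<bullet> (y - x)\<bar> \<le> C * (norm (y - x))\<^sup>2"
    using r by (auto simp: glue_def)
  then show "\<exists>C d. 0 < d \<and> (\<forall>y\<in>ball x d. \<bar>glue x r \<phi> u y - glue x r \<phi> u x - D \<bullet> (y - x)\<bar> \<le> C * (norm (y - x))\<^sup>2)"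
    using Cd(1) by blast
qed

text \<open>\<open>E\<close> is a set of displacements at distance at least \<open>r\<close>, where
  the glued function is still \<open>u\<close>. The gap \<open>\<phi> - u\<close> there lowers the
  nonlocal term by at least \<open>lam\<close> times its kernel integral, while the curvature bound
  \<open>p\<close> of \<open>\<phi>\<close> costs \<open>Lam / 2\<close> times its own.\<close>

lemma subsolution_test:
  fixes u :: "'a::euclidean_space \<Rightarrow> real"
  assumes s: "1/2 < s" "s < 1" and lam: "0 < lam" "lam \<le> Lam"
    and ell: "elliptic s lam Lam I" and hom: "positively_homogeneous s I"
    and sub: "viscosity_subsolution s I (\<lambda>x r p. norm p powr m) UNIV u"
    and \<phi>: "C2_on UNIV \<phi>" "GDERIV \<phi> x :> D"
    and touch: "u x = \<phi> x" "\<And>y. u y \<le> \<phi> y"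
    and r: "0 < r" "\<And>z. z \<in> E \<Longrightarrow> r \<le> norm z"
    and p: "\<And>z. 0 \<le> p z" "integrable lebesgue (\<lambda>z. p z * frac_kernel s z)"
    and q: "integrable lebesgue (\<lambda>z. indicator E z * (\<phi> (x + z) - u (x + z)) * frac_kernel s z)"
    and diff: "\<And>z. \<phi> (x + z) + \<phi> (x - z) - 2 * \<phi> x \<le> p z"
  shows "norm D powr m \<le> Lam / 2 * (LINT z|lebesgue. p z * frac_kernel s z)
     - lam * (LINT z|lebesgue. indicator E z * (\<phi> (x + z) - u (x + z)) * frac_kernel s z)" (is "_ \<le> ?B")
proof -
  let ?v = "glue x r \<phi> u" and ?q = "\<lambda>z. indicator E z * (\<phi> (x + z) - u (x + z))"
  have v: "?v \<in> L1_weight s"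
    by (rule glue_L1_weight[OF _ C2_on_imp_continuous_on[OF \<phi>(1)]])
      (use sub in \<open>simp add: viscosity_subsolution_def\<close>)
  obtain C d where Cd: "0 < d" "\<forall>y\<in>ball x d. \<bar>?v y - ?v x - D \<bullet> (y - x)\<bar> \<le> C * (norm (y - x))\<^sup>2"
    using glue_regular(2)[OF \<phi> r(1)] by blast
  then have C11: "?v \<in> C11_at x" unfolding C11_at_def by blast
  have q0: "0 \<le> ?q z" for z using touch(2) by (simp add: indicator_def)
  have vq: "?v (x + z) \<le> \<phi> (x + z) - ?q z" for z
    using touch(2)[of "x + z"] r(2)[of z] by (auto simp: glue_def dist_norm indicator_def)
  have vx: "?v x = \<phi> x" using r by (simp add: glue_def)
  have "I ?v x \<le> ?B"
  proof (rule elliptic_bounds(1)[OF ell hom lam C11 v])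
    fix K :: "'a \<Rightarrow> real" assume K: "K \<in> K_sym s lam Lam"
    show "L_op s K ?v x \<le> ?B"
    proof (rule L_op_le[OF s lam(1) K v grad_eqI[OF glue_regular(1)[OF \<phi> r(1)]] Cd p q0 q])
      show "?v (x + z) + ?v (x - z) - 2 * ?v x \<le> p z - ?q z - ?q (- z)" for z
        using vq[of z] vq[of "- z"] diff[of z] unfolding vx by simp
    qed
  qed
  moreover have "- I ?v x + norm (grad \<phi> x) powr m \<le> 0"
  proof -
    have "C2_on (ball x r) \<phi>" using \<phi>(1) by (rule C2_on_subset) simp
    moreover have "\<forall>y\<in>ball x r. u y \<le> \<phi> y" using touch(2) by simp
    moreover have "\<forall>r>0. \<forall>\<phi>. C2_on (ball x r) \<phi> \<longrightarrow> u x = \<phi> x \<longrightarrow> (\<forall>y\<in>ball x r. u y \<le> \<phi> y) \<longrightarrow>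
        glue x r \<phi> u \<in> L1_weight s \<longrightarrow> - I (glue x r \<phi> u) x + norm (grad \<phi> x) powr m \<le> 0"
      using sub unfolding viscosity_subsolution_def glue_def[abs_def] Let_def by blast
    ultimately show ?thesis using r(1) touch(1) v by blast
  qed
  ultimately show ?thesis using grad_eqI[OF \<phi>(2)] by simp
qed

text \<open>Here the gap of \<open>u\<close> above the test function raises the nonlocal term, and
  the gradient limits how large it can be: an averaged bound on \<open>u\<close> from above.\<close>

lemma supersolution_test:
  fixes u :: "'a::euclidean_space \<Rightarrow> real"
  assumes s: "1/2 < s" "s < 1" and lam: "0 < lam" "lam \<le> Lam"
    and ell: "elliptic s lam Lam I" and hom: "positively_homogeneous s I"
    and sup: "viscosity_supersolution s I (\<lambda>x r p. norm p powr m) UNIV u"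
    and \<phi>: "C2_on UNIV \<phi>" "GDERIV \<phi> x :> D"
    and touch: "u x = \<phi> x" "\<And>y. \<phi> y \<le> u y"
    and r: "0 < r" "\<And>z. z \<in> E \<Longrightarrow> r \<le> norm z"
    and p: "\<And>z. 0 \<le> p z" "integrable lebesgue (\<lambda>z. p z * frac_kernel s z)"
    and q: "integrable lebesgue (\<lambda>z. indicator E z * (u (x + z) - \<phi> (x + z)) * frac_kernel s z)"
    and diff: "\<And>z. - p z \<le> \<phi> (x + z) + \<phi> (x - z) - 2 * \<phi> x"
  shows "lam * (LINT z|lebesgue. indicator E z * (u (x + z) - \<phi> (x + z)) * frac_kernel s z)
     - Lam / 2 * (LINT z|lebesgue. p z * frac_kernel s z) \<le> norm D powr m" (is "?B \<le> _")
proof -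
  let ?v = "glue x r \<phi> u" and ?q = "\<lambda>z. indicator E z * (u (x + z) - \<phi> (x + z))"
  have v: "?v \<in> L1_weight s"
    by (rule glue_L1_weight[OF _ C2_on_imp_continuous_on[OF \<phi>(1)]])
      (use sup in \<open>simp add: viscosity_supersolution_def\<close>)
  obtain C d where Cd: "0 < d" "\<forall>y\<in>ball x d. \<bar>?v y - ?v x - D \<bullet> (y - x)\<bar> \<le> C * (norm (y - x))\<^sup>2"
    using glue_regular(2)[OF \<phi> r(1)] by blast
  then have C11: "?v \<in> C11_at x" unfolding C11_at_def by blast
  have q0: "0 \<le> ?q z" for z using touch(2) by (simp add: indicator_def)
  have vq: "\<phi> (x + z) + ?q z \<le> ?v (x + z)" for z
    using touch(2)[of "x + z"] r(2)[of z] by (auto simp: glue_def dist_norm indicator_def)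
  have vx: "?v x = \<phi> x" using r by (simp add: glue_def)
  have "?B \<le> I ?v x"
  proof (rule elliptic_bounds(2)[OF ell hom lam C11 v])
    fix K :: "'a \<Rightarrow> real" assume K: "K \<in> K_sym s lam Lam"
    show "?B \<le> L_op s K ?v x"
    proof (rule L_op_ge[OF s lam(1) K v glue_regular(1)[OF \<phi> r(1)] Cd p q0 q])
      show "?q z + ?q (- z) - p z \<le> ?v (x + z) + ?v (x - z) - 2 * ?v x" for z
        using vq[of z] vq[of "- z"] diff[of z] unfolding vx by simp
    qed
  qed
  moreover have "- I ?v x + norm (grad \<phi> x) powr m \<ge> 0"
  proof -
    have "C2_on (ball x r) \<phi>" using \<phi>(1) by (rule C2_on_subset) simp
    moreover have "\<forall>y\<in>ball x r. \<phi> y \<le> u y" using touch(2) by simp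
    moreover have "\<forall>r>0. \<forall>\<phi>. C2_on (ball x r) \<phi> \<longrightarrow> u x = \<phi> x \<longrightarrow> (\<forall>y\<in>ball x r. \<phi> y \<le> u y) \<longrightarrow>
        glue x r \<phi> u \<in> L1_weight s \<longrightarrow> - I (glue x r \<phi> u) x + norm (grad \<phi> x) powr m \<ge> 0"
      using sup unfolding viscosity_supersolution_def glue_def[abs_def] Let_def by blast
    ultimately show ?thesis using r(1) touch(1) v by blast
  qed
  ultimately show ?thesis using grad_eqI[OF \<phi>(2)] by simp
qed

section \<open>Growth, maxima and annuli\<close>

lemma eventually_powr_less:
  fixes e c k :: real
  assumes "e < 0" "0 < k"
  shows "eventually (\<lambda>x. c * x powr e < k) at_top"
proof -
  have "((\<lambda>x. c * x powr e) \<longlongrightarrow> c * 0) at_top"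
    by (intro tendsto_intros tendsto_neg_powr assms filterlim_ident)
  then show ?thesis using assms(2) by (intro order_tendstoD) auto
qed

lemma semicontinuous_imp_continuous:
  fixes u :: "'a::t2_space \<Rightarrow> real"
  assumes "upper_semicontinuous_on UNIV u" "lower_semicontinuous_on UNIV u"
  shows "continuous_on UNIV u"
proof -
  have "isCont u x" for x
    unfolding isCont_def
    using assms by (intro order_tendstoI) (auto simp: upper_semicontinuous_on_def lower_semicontinuous_on_def)
  then show ?thesis by (simp add: continuous_at_imp_continuous_on)
qed

lemma growth_constant_nonneg:
  fixes f :: "'a::real_normed_vector \<Rightarrow> real"
  assumes "\<And>y. \<bar>f y\<bar> \<le> M * (1 + norm y) powr g"
  shows "0 \<le> M"
proof -
  have "0 \<le> M * (1 + norm (0::'a)) powr g" using assms[of 0] by linarith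
  then show ?thesis by simp
qed

text \<open>Since \<open>g < g'\<close>, the difference far from \<open>c\<close> lies below its
  value at \<open>c\<close>, so a maximum over a large ball is global.\<close>

lemma maximum_attained:
  fixes f \<phi> :: "'a::euclidean_space \<Rightarrow> real"
  assumes f: "continuous_on UNIV f" "\<And>y. f y \<le> M * (1 + norm y) powr g"
    and \<phi>: "continuous_on UNIV \<phi>" "\<And>y. A * norm (y - c) powr g' + B \<le> \<phi> y"
    and pos: "0 \<le> M" "0 < A" "0 \<le> g" "g < g'"
  obtains y0 where "\<And>y. f y - \<phi> y \<le> f y0 - \<phi> y0"
proof -
  \<comment> \<open>\<open>L\<close> absorbs both the offset of the lower bound for
    \<open>\<phi>\<close> and the value at \<open>c\<close>; half of the growth of
    \<open>\<phi>\<close> beats \<open>f\<close>, the other half beats \<open>L\<close>.\<close>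
  define L where "L = \<bar>B\<bar> + \<bar>f c - \<phi> c\<bar>"
  have "eventually (\<lambda>d. M * 2 powr g * d powr (g - g') < A / 2 \<and> L * d powr (- g') < A / 2 \<and> 1 + norm c \<le> d) at_top"
    using pos by (intro eventually_conj eventually_powr_less eventually_ge_at_top) auto
  then obtain T where T: "\<And>d. T \<le> d \<Longrightarrow>
      M * 2 powr g * d powr (g - g') < A / 2 \<and> L * d powr (- g') < A / 2 \<and> 1 + norm c \<le> d"
    unfolding eventually_at_top_linorder by blast
  define T' where "T' = max T 0"
  have far: "f y - \<phi> y \<le> f c - \<phi> c" if "T' \<le> norm (y - c)" for y
  proof -
    let ?d = "norm (y - c)"
    have d: "M * 2 powr g * ?d powr (g - g') < A / 2" "L * ?d powr (- g') < A / 2" "1 + norm c \<le> ?d"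
      using T[of ?d] that by (auto simp: T'_def)
    have d0: "0 < ?d" using d(3) norm_ge_zero[of c] by linarith
    have "norm y \<le> ?d + norm c" using norm_triangle_sub[of y c] by linarith
    then have "M * (1 + norm y) powr g \<le> M * (2 * ?d) powr g"
      using d(3) pos by (intro mult_left_mono powr_mono2) auto
    also have "\<dots> = (M * 2 powr g * ?d powr (g - g')) * ?d powr g'"
      using d0 by (simp add: powr_mult powr_diff)
    also have "\<dots> \<le> A / 2 * ?d powr g'"
      using d(1) by (intro mult_right_mono) auto
    finally have 1: "f y \<le> A / 2 * ?d powr g'" using f(2)[of y] by linarith
    have "L * ?d powr (- g') * ?d powr g' \<le> A / 2 * ?d powr g'"
      using d(2) by (intro mult_right_mono) auto
    moreover have "?d powr (- g') * ?d powr g' = 1" using d0 by (simp add: powr_add[symmetric])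
    ultimately have "L \<le> A / 2 * ?d powr g'" by (simp add: mult.assoc)
    then show ?thesis using 1 \<phi>(2)[of y] unfolding L_def by linarith
  qed
  have "\<exists>y0\<in>cball c T'. \<forall>y\<in>cball c T'. f y - \<phi> y \<le> f y0 - \<phi> y0"
    by (rule continuous_attains_sup)
      (auto intro!: continuous_intros continuous_on_subset[OF f(1)] continuous_on_subset[OF \<phi>(1)] simp: T'_def)
  then obtain y0 where y0: "\<And>y. y \<in> cball c T' \<Longrightarrow> f y - \<phi> y \<le> f y0 - \<phi> y0" by blast
  have "f y - \<phi> y \<le> f y0 - \<phi> y0" for y
  proof (cases "y \<in> cball c T'")
    case False
    then have "f y - \<phi> y \<le> f c - \<phi> c"
      using far[of y] by (auto simp: dist_norm norm_minus_commute)
    also have "\<dots> \<le> f y0 - \<phi> y0" using y0[of c] by (simp add: T'_def)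
    finally show ?thesis .
  qed (rule y0)
  then show thesis by (rule that)
qed

text \<open>The majorant of the second differences of \<open>rad t powr b\<close> at
  \<open>x\<close>. Its kernel integral, of order \<open>rad t x powr (b - 2 * s)\<close>, is the
  diffusion cost of that power.\<close>

definition profile :: "real \<Rightarrow> real \<Rightarrow> 'a::euclidean_space \<Rightarrow> 'a \<Rightarrow> real" where
  "profile t b x z = 8 * rad t x powr b * min ((norm z / rad t x)\<^sup>2) ((norm z / rad t x) powr b)"

lemma profile_nonneg: "0 \<le> profile t b x z"
  by (simp add: profile_def)

lemma profile_integral:
  fixes x :: "'a::euclidean_space"
  assumes "0 < s" "s < 1" "0 \<le> b" "b < 2 * s" "0 < t"
  shows "integrable lebesgue (\<lambda>z. profile t b x z * frac_kernel s z)"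
    and "(LINT z|lebesgue. profile t b x z * frac_kernel s z)
      = 8 * rad t x powr (b - 2 * s) * moment_mass TYPE('a) s b"
proof -
  note st = scaled_moment_kernel[OF assms(1-4) rad_pos[OF assms(5)], of x, where 'a = 'a]
  show "integrable lebesgue (\<lambda>z. profile t b x z * frac_kernel s z)"
    unfolding profile_def mult.assoc[of "8 * rad t x powr b"] by (intro integrable_mult_right st(1))
  have "rad t x powr b * rad t x powr (- 2 * s) = rad t x powr (b - 2 * s)"
    by (simp add: powr_add[symmetric])
  then show "(LINT z|lebesgue. profile t b x z * frac_kernel s z)
      = 8 * rad t x powr (b - 2 * s) * moment_mass TYPE('a) s b"
    unfolding profile_def mult.assoc[of "8 * rad t x powr b"] integral_mult_right_zero st(2)
    by (simp add: mult.assoc[symmetric])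
qed

lemma rad_powr_second_difference':
  fixes x z c :: "'a::euclidean_space"
  assumes "0 < t" "0 \<le> b" "b \<le> 2"
  shows "rad t (x + z - c) powr b + rad t (x - z - c) powr b - 2 * rad t (x - c) powr b \<le> profile t b (x - c) z"
  using rad_powr_second_difference[OF assms, of "x - c" z]
  unfolding profile_def by (simp add: algebra_simps)

section \<open>Integration over annuli\<close>

lemma integrable_annulus_kernel:
  fixes f :: "'a::euclidean_space \<Rightarrow> real"
  assumes f: "continuous_on UNIV f" and S: "S \<in> sets lebesgue" "bounded S"
    and r: "0 < r" "\<And>z. z \<in> S \<Longrightarrow> r \<le> norm z"
  shows "integrable lebesgue (\<lambda>z. indicator S z * f z * frac_kernel s z)"
proof -
  \<comment> \<open>Truncating the norm at \<open>r\<close> makes the kernel continuous everywhere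
    and does not change it on \<open>S\<close>.\<close>
  let ?g = "\<lambda>z::'a. max r (norm z) powr - (real DIM('a) + 2 * s)"
  have "max r (norm z) \<noteq> 0" for z :: 'a using r(1) by (auto simp: max_def)
  then have "integrable lebesgue (\<lambda>z. indicator S z * (f z * ?g z))"
    by (intro integrable_indicator_continuous S continuous_intros f) auto
  moreover have "indicator S z * (f z * ?g z) = indicator S z * f z * frac_kernel s z" for z
    using r(2)[of z] by (auto simp: indicator_def frac_kernel_def max_def)
  ultimately show ?thesis by (simp only:)
qed

lemma measure_ball_pos: "0 < r \<Longrightarrow> 0 < measure lebesgue (ball (c::'a::euclidean_space) r)"
  using content_ball_pos[of r c] by simp

text \<open>Dimension one is the worst case. The bound 1/4 is small enough that two such balls can
  be removed and half of the measure is kept.\<close>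

lemma measure_ball_quarter:
  fixes c d :: "'a::euclidean_space"
  assumes "0 < r"
  shows "measure lebesgue (ball c (r / 4)) \<le> 1 / 4 * measure lebesgue (ball d r)"
proof -
  have "(1 / 4) ^ DIM('a) \<le> (1 / 4 :: real) ^ 1" by (intro power_decreasing) auto
  then have "(r / 4) ^ DIM('a) \<le> 1 / 4 * r ^ DIM('a)"
    using assms by (simp add: power_divide field_simps)
  then have "(r / 4) ^ DIM('a) * measure lborel (ball (0::'a) 1) \<le> 1 / 4 * r ^ DIM('a) * measure lborel (ball (0::'a) 1)"
    by (rule mult_right_mono) simp
  then show ?thesis
    using assms content_ball_conv_unit_ball[of "r / 4" c] content_ball_conv_unit_ball[of r d]
    by (simp add: mult.assoc)
qed

text \<open>The hole leaves room for the ball on which a test function replaces \<open>u\<close>.\<close>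

definition annulus :: "'a::euclidean_space \<Rightarrow> real \<Rightarrow> 'a set" where
  "annulus c r = ball c r - ball c (r / 4)"

lemma annulus_sets [simp, measurable]: "annulus c r \<in> sets lebesgue"
  unfolding annulus_def by simp

lemma bounded_annulus [simp]: "bounded (annulus c r)"
  unfolding annulus_def by (rule bounded_diff) simp

lemma annulus_shift: "x + z \<in> annulus c r \<longleftrightarrow> z \<in> annulus (c - x) r"
  unfolding annulus_def by (simp add: dist_norm algebra_simps)

section \<open>Barriers for sub- and supersolutions\<close>

locale viscosity_HJ =
  fixes s m lam Lam :: real
    and I :: "('a::euclidean_space \<Rightarrow> real) \<Rightarrow> 'a \<Rightarrow> real"
    and u :: "'a \<Rightarrow> real"
  assumes s: "1/2 < s" "s < 1"
    and m: "1 < m"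
    and lam: "0 < lam" "lam \<le> Lam"
    and hom: "positively_homogeneous s I"
    and ell: "elliptic s lam Lam I"
    and sol: "viscosity_solution s I (\<lambda>x r p. norm p powr m) UNIV u"
begin

lemma continuous_u: "continuous_on UNIV u"
  using sol unfolding viscosity_solution_def viscosity_subsolution_def viscosity_supersolution_def
  by (intro semicontinuous_imp_continuous) auto

text \<open>If the barrier is exceeded, lift it until it touches \<open>u\<close> from above at a
  maximum point \<open>x\<close> of the difference. For \<open>x\<close> at distance at least
  \<open>\<rho>\<close> from \<open>c\<close>, \<open>outside\<close> says that the gradient is too
  large for a subsolution. For closer \<open>x\<close> the gradient is discarded and the gap on the
  annulus is used: the barrier stays above \<open>l + A2 * R powr b\<close> there, while
  \<open>average\<close> keeps \<open>u\<close> below this level in mean.\<close>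

lemma subsolution_barrier:
  fixes c :: 'a
  assumes growth: "\<And>y::'a. u y \<le> M * (1 + norm y) powr g" "0 \<le> M" "0 \<le> g" "g < b"
    and ab: "0 < a" "a < 2 * s" "b < 2 * s"
    and \<rho>: "0 < \<rho>" "\<rho> \<le> R" and A: "0 < A1" "0 < A2"
    and average: "(LINT y|lebesgue. indicator (annulus c \<rho>) y * max 0 (u y - l))
        \<le> 1 / 4 * (A2 * R powr b) * measure lebesgue (ball c \<rho>)"
    and inside: "4 * Lam * (A1 * moment_mass TYPE('a) s a * \<rho> powr (a - 2 * s)
          + A2 * moment_mass TYPE('a) s b * R powr (b - 2 * s))
        < lam * (2 * \<rho>) powr - (real DIM('a) + 2 * s) * (1 / 4 * (A2 * R powr b) * measure lebesgue (ball c \<rho>))"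
    and outside: "\<And>x::'a. \<rho> \<le> norm x \<Longrightarrow>
        4 * Lam * (A1 * moment_mass TYPE('a) s a * rad \<rho> x powr (a - 2 * s)
          + A2 * moment_mass TYPE('a) s b * rad R x powr (b - 2 * s))
        < (A1 * a * rad \<rho> x powr (a - 2) * norm x + A2 * b * rad R x powr (b - 2) * norm x) powr m"
  shows "u y \<le> l + A1 * rad \<rho> (y - c) powr a + A2 * rad R (y - c) powr b"
proof -
  have R: "0 < R" using \<rho> by linarith
  have b: "0 < b" using growth by linarith
  have s0: "0 < s" using s by linarith
  have sub: "viscosity_subsolution s I (\<lambda>x r p. norm p powr m) UNIV u"
    using sol unfolding viscosity_solution_def by blast
  define \<phi>0 where "\<phi>0 y = l + A1 * rad \<rho> (y - c) powr a + A2 * rad R (y - c) powr b" for y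
  have C2_0: "C2_on UNIV \<phi>0"
    unfolding \<phi>0_def[abs_def]
    by (intro C2_on_add C2_on_const C2_on_cmult C2_on_rad_powr \<rho>(1) R)
  have cont0: "continuous_on UNIV \<phi>0" using C2_0 by (rule C2_on_imp_continuous_on)
  obtain x where x: "\<And>y. u y - \<phi>0 y \<le> u x - \<phi>0 x"
  proof (rule maximum_attained[OF continuous_u growth(1) cont0 _ growth(2) A(2) growth(3,4)])
    show "A2 * norm (y - c) powr b + l \<le> \<phi>0 y" for y
    proof -
      have "norm (y - c) powr b \<le> rad R (y - c) powr b"
        using b rad_ge(2)[of "y - c" R] by (intro powr_mono2) auto
      then have "A2 * norm (y - c) powr b \<le> A2 * rad R (y - c) powr b"
        using A by simp
      moreover have "0 \<le> A1 * rad \<rho> (y - c) powr a" using A by simp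
      ultimately show ?thesis unfolding \<phi>0_def by linarith
    qed
  qed blast
  show ?thesis
  proof (rule ccontr)
    assume "\<not> ?thesis"
    then have \<sigma>: "0 < u x - \<phi>0 x" using x[of y] unfolding \<phi>0_def by linarith
    \<comment> \<open>The lift is positive, so the lower bound \<open>l + A2 * R powr b\<close> of
      the barrier survives.\<close>
    define \<phi> where "\<phi> y = (u x - \<phi>0 x) + \<phi>0 y" for y
    have C2: "C2_on UNIV \<phi>"
      unfolding \<phi>_def[abs_def] by (intro C2_on_add C2_on_const C2_0)
    have cont: "continuous_on UNIV \<phi>" using C2 by (rule C2_on_imp_continuous_on)
    have touch: "u x = \<phi> x" "\<And>y. u y \<le> \<phi> y"
      using x by (auto simp: \<phi>_def algebra_simps)
    have low: "l + A2 * R powr b \<le> \<phi> y" for y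
    proof -
      have "R powr b \<le> rad R (y - c) powr b"
        using R b rad_ge(1)[OF R] by (intro powr_mono2) auto
      then have "A2 * R powr b \<le> A2 * rad R (y - c) powr b" using A by simp
      moreover have "0 \<le> A1 * rad \<rho> (y - c) powr a" using A by simp
      ultimately show ?thesis using \<sigma> unfolding \<phi>_def \<phi>0_def by linarith
    qed
    let ?k = "A1 * (a * rad \<rho> (x - c) powr (a - 2)) + A2 * (b * rad R (x - c) powr (b - 2))"
    have grad: "GDERIV \<phi> x :> ?k *\<^sub>R (x - c)"
    proof -
      have "(\<phi> has_derivative (\<lambda>h. A1 * (a * rad \<rho> (x - c) powr (a - 2) * (h \<bullet> (x - c)))
          + A2 * (b * rad R (x - c) powr (b - 2) * (h \<bullet> (x - c))))) (at x)"
        unfolding \<phi>_def[abs_def] \<phi>0_def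
        by (rule has_derivative_eq_rhs)
          (rule derivative_intros has_derivative_rad_powr \<rho>(1) R refl | simp add: fun_eq_iff)+
      then show ?thesis unfolding gderiv_def by (simp add: algebra_simps)
    qed
    define p where "p z = A1 * profile \<rho> a (x - c) z + A2 * profile R b (x - c) z" for z
    have p0: "0 \<le> p z" for z unfolding p_def using A by (simp add: profile_nonneg)
    have diff: "\<phi> (x + z) + \<phi> (x - z) - 2 * \<phi> x \<le> p z" for z
    proof -
      have "A1 * (rad \<rho> (x + z - c) powr a + rad \<rho> (x - z - c) powr a - 2 * rad \<rho> (x - c) powr a)
          \<le> A1 * profile \<rho> a (x - c) z"
        using ab s A by (intro mult_left_mono rad_powr_second_difference' \<rho>(1)) auto
      moreover have "A2 * (rad R (x + z - c) powr b + rad R (x - z - c) powr b - 2 * rad R (x - c) powr b)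
          \<le> A2 * profile R b (x - c) z"
        using ab b s A by (intro mult_left_mono rad_powr_second_difference' R) auto
      ultimately show ?thesis unfolding \<phi>_def \<phi>0_def p_def by (simp add: algebra_simps)
    qed
    note pa = profile_integral[OF s0 s(2) less_imp_le[OF ab(1)] ab(2) \<rho>(1), of "x - c"]
    note pb = profile_integral[OF s0 s(2) less_imp_le[OF b] ab(3) R, of "x - c"]
    have pi: "integrable lebesgue (\<lambda>z. p z * frac_kernel s z)"
      unfolding p_def distrib_right mult.assoc using pa(1) pb(1) by simp
    \<comment> \<open>The 4 is the factor 8 of \<open>profile\<close> times the 1/2 in
      \<open>Lam / 2\<close>.\<close>
    let ?B = "4 * Lam * (A1 * moment_mass TYPE('a) s a * rad \<rho> (x - c) powr (a - 2 * s)
          + A2 * moment_mass TYPE('a) s b * rad R (x - c) powr (b - 2 * s))"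
    have pI: "Lam / 2 * (LINT z|lebesgue. p z * frac_kernel s z) = ?B"
      unfolding p_def distrib_right mult.assoc using pa pb by (simp add: algebra_simps)
    show False
    proof (cases "\<rho> \<le> norm (x - c)")
      \<comment> \<open>The test is made with no gap set at all, hence an arbitrary gluing
        radius.\<close>
      case True
      have "norm (?k *\<^sub>R (x - c)) powr m \<le> ?B"
        using subsolution_test[OF s lam ell hom sub C2 grad touch zero_less_one, of "{}" p] p0 pi diff
        unfolding pI by simp
      moreover have "norm (?k *\<^sub>R (x - c)) = A1 * a * rad \<rho> (x - c) powr (a - 2) * norm (x - c)
          + A2 * b * rad R (x - c) powr (b - 2) * norm (x - c)"
      proof -
        have "0 \<le> ?k" using A ab b by (intro add_nonneg_nonneg mult_nonneg_nonneg) auto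
        then show ?thesis by (simp add: distrib_right mult.assoc)
      qed
      ultimately show False using outside[OF True] by simp
    next
      case False
      let ?N = "real DIM('a) + 2 * s"
      \<comment> \<open>In displacements from \<open>x\<close>: the annulus around \<open>c\<close>,
        less a ball around \<open>x\<close> in which the test function replaces
        \<open>u\<close>.\<close>
      define E where "E = annulus (c - x) \<rho> - ball 0 (\<rho> / 4)"
      have Es: "E \<in> sets lebesgue" "bounded E"
        unfolding E_def by (auto intro: bounded_subset[OF bounded_annulus[of "c - x" \<rho>]])
      have E1: "\<rho> / 4 \<le> norm z" "z \<in> annulus (c - x) \<rho>" if "z \<in> E" for z
        using that by (auto simp: E_def)
      \<comment> \<open>Both \<open>x\<close> and \<open>x + z\<close> lie within
        \<open>\<rho>\<close> of \<open>c\<close>, so the kernel is at least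
        \<open>(2 * \<rho>) powr - ?N\<close> on \<open>E\<close>.\<close>
      have E2: "norm z \<le> 2 * \<rho>" if "z \<in> E" for z
      proof -
        have "norm (z - (c - x)) < \<rho>" using E1(2)[OF that]
          by (simp add: annulus_def dist_norm norm_minus_commute)
        then show ?thesis using False norm_triangle_ineq[of "z - (c - x)" "c - x"]
          by (simp add: norm_minus_commute)
      qed
      have cshift: "continuous_on UNIV (\<lambda>z. \<phi> (x + z) - u (x + z))"
        by (intro continuous_intros continuous_on_compose2[OF cont] continuous_on_compose2[OF continuous_u]) auto
      have ucont: "continuous_on UNIV (\<lambda>z. max 0 (u z - l))"
        by (intro continuous_intros continuous_u)
      have umax: "continuous_on UNIV (\<lambda>z. max 0 (u (x + z) - l))"
        by (intro continuous_intros continuous_on_compose2[OF continuous_u]) auto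
      have q: "integrable lebesgue (\<lambda>z. indicator E z * (\<phi> (x + z) - u (x + z)) * frac_kernel s z)"
        using Es E1(1) \<rho> by (intro integrable_annulus_kernel[OF cshift, of _ "\<rho> / 4"]) auto
      have test: "norm (?k *\<^sub>R (x - c)) powr m \<le> ?B
         - lam * (LINT z|lebesgue. indicator E z * (\<phi> (x + z) - u (x + z)) * frac_kernel s z)"
        unfolding pI[symmetric]
        by (rule subsolution_test[OF s lam ell hom sub C2 grad touch, of "\<rho> / 4"])
          (use \<rho> E1(1) p0 pi q diff in auto)
      let ?h = "A2 * R powr b"
      have iE: "integrable lebesgue (\<lambda>z. indicator E z * ?h)"
        by (intro integrable_indicator_continuous Es) simp
      have iEm: "integrable lebesgue (\<lambda>z. indicator E z * max 0 (u (x + z) - l))"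
        by (intro integrable_indicator_continuous Es umax)
      have ia: "integrable lebesgue (\<lambda>y. indicator (annulus c \<rho>) y * max 0 (u y - l))"
        by (intro integrable_indicator_continuous ucont) auto
      have "(2 * \<rho>) powr - ?N * (LINT z|lebesgue. indicator E z * ?h - indicator E z * max 0 (u (x + z) - l))
          = (LINT z|lebesgue. (2 * \<rho>) powr - ?N * (indicator E z * ?h - indicator E z * max 0 (u (x + z) - l)))"
        by simp
      also have "\<dots> \<le> (LINT z|lebesgue. indicator E z * (\<phi> (x + z) - u (x + z)) * frac_kernel s z)"
      proof (rule integral_mono[OF _ q])
        show "integrable lebesgue (\<lambda>z. (2 * \<rho>) powr - ?N * (indicator E z * ?h - indicator E z * max 0 (u (x + z) - l)))"
          using iE iEm by auto
        fix z :: 'a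
        show "(2 * \<rho>) powr - ?N * (indicator E z * ?h - indicator E z * max 0 (u (x + z) - l))
            \<le> indicator E z * (\<phi> (x + z) - u (x + z)) * frac_kernel s z"
        proof (cases "z \<in> E")
          case True
          have "0 < norm z" using E1(1)[OF True] \<rho> by linarith
          then have N: "(2 * \<rho>) powr - ?N \<le> frac_kernel s z"
            unfolding frac_kernel_def using E2[OF True] s0 by (intro powr_mono2') auto
          have "(2 * \<rho>) powr - ?N * (?h - max 0 (u (x + z) - l)) \<le> (2 * \<rho>) powr - ?N * (\<phi> (x + z) - u (x + z))"
            using low[of "x + z"] touch(2)[of "x + z"] by (intro mult_left_mono) auto
          also have "\<dots> \<le> frac_kernel s z * (\<phi> (x + z) - u (x + z))"
            using N touch(2)[of "x + z"] by (intro mult_right_mono) auto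
          finally show ?thesis using True by (simp add: mult.commute)
        qed simp
      qed
      finally have 1: "(2 * \<rho>) powr - ?N * (LINT z|lebesgue. indicator E z * ?h - indicator E z * max 0 (u (x + z) - l))
          \<le> (LINT z|lebesgue. indicator E z * (\<phi> (x + z) - u (x + z)) * frac_kernel s z)" .
      have "(LINT z|lebesgue. indicator E z * max 0 (u (x + z) - l))
          \<le> (LINT z|lebesgue. indicator (annulus c \<rho>) (x + z) * max 0 (u (x + z) - l))"
        using iEm integrable_lebesgue_shift[OF ia, of x] E1(2)
        by (intro integral_mono) (auto simp: indicator_def annulus_shift)
      also have "\<dots> = (LINT y|lebesgue. indicator (annulus c \<rho>) y * max 0 (u y - l))"
        using integral_lebesgue_shift[OF borel_measurable_integrable[OF ia], of x] by simp
      finally have 2: "(LINT z|lebesgue. indicator E z * max 0 (u (x + z) - l))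
          \<le> 1 / 4 * ?h * measure lebesgue (ball c \<rho>)" using average by linarith
      \<comment> \<open>The two removed balls take at most a quarter each. Of the remaining half,
        \<open>average\<close> consumes a quarter, and a quarter of
        \<open>?h * measure lebesgue (ball c \<rho>)\<close> is left as gain.\<close>
      have mE: "1 / 2 * measure lebesgue (ball c \<rho>) \<le> measure lebesgue E"
      proof -
        let ?B0 = "ball (c - x) \<rho>" and ?B1 = "ball (c - x) (\<rho> / 4)" and ?B2 = "ball (0::'a) (\<rho> / 4)"
        have fm: "?B0 \<in> fmeasurable lebesgue" "?B1 \<in> fmeasurable lebesgue" "?B2 \<in> fmeasurable lebesgue"
          by auto
        then have fE: "E \<in> fmeasurable lebesgue"
          unfolding E_def annulus_def by (intro fmeasurable.Diff)
        have "measure lebesgue ?B0 \<le> measure lebesgue ((E \<union> ?B1) \<union> ?B2)"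
        proof (rule measure_mono_fmeasurable)
          show "?B0 \<subseteq> (E \<union> ?B1) \<union> ?B2" by (auto simp: E_def annulus_def)
        qed (use fm fE in \<open>auto intro!: fmeasurable.Un\<close>)
        also have "\<dots> \<le> measure lebesgue (E \<union> ?B1) + measure lebesgue ?B2"
          using Es by (intro measure_Un_le) auto
        also have "measure lebesgue (E \<union> ?B1) \<le> measure lebesgue E + measure lebesgue ?B1"
          using Es by (intro measure_Un_le) auto
        finally have "measure lebesgue ?B0 \<le> measure lebesgue E + measure lebesgue ?B1 + measure lebesgue ?B2"
          by simp
        moreover have "measure lebesgue ?B0 = measure lebesgue (ball c \<rho>)"
          using \<rho> content_ball_conv_unit_ball[of \<rho> "c - x"] content_ball_conv_unit_ball[of \<rho> c] by simp
        ultimately show ?thesis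
          using measure_ball_quarter[OF \<rho>(1), of "c - x" c] measure_ball_quarter[OF \<rho>(1), of 0 c] by linarith
      qed
      have "(LINT z|lebesgue. indicator E z * ?h) = measure lebesgue E * ?h"
        using Es by simp
      moreover have "1 / 2 * measure lebesgue (ball c \<rho>) * ?h \<le> measure lebesgue E * ?h"
        using mE A by (intro mult_right_mono) auto
      ultimately have "1 / 4 * ?h * measure lebesgue (ball c \<rho>)
          \<le> (LINT z|lebesgue. indicator E z * ?h - indicator E z * max 0 (u (x + z) - l))"
        using 2 unfolding Bochner_Integration.integral_diff[OF iE iEm]
          mult.commute[of "1 / 4 * ?h"] mult.left_commute[of _ "1 / 4"] mult.assoc[of "1 / 2"] by linarith
      then have "(2 * \<rho>) powr - ?N * (1 / 4 * ?h * measure lebesgue (ball c \<rho>))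
          \<le> (LINT z|lebesgue. indicator E z * (\<phi> (x + z) - u (x + z)) * frac_kernel s z)"
        using 1 mult_left_mono[OF _ powr_ge_zero[of "2 * \<rho>" "- ?N"]] by (meson order_trans)
      then have "lam * ((2 * \<rho>) powr - ?N * (1 / 4 * ?h * measure lebesgue (ball c \<rho>)))
          \<le> lam * (LINT z|lebesgue. indicator E z * (\<phi> (x + z) - u (x + z)) * frac_kernel s z)"
        using lam by (intro mult_left_mono) auto
      \<comment> \<open>The powers are negative and \<open>rad\<close> is at least its smoothing
        length, so the diffusion cost is largest at the centre.\<close>
      moreover have "?B \<le> 4 * Lam * (A1 * moment_mass TYPE('a) s a * \<rho> powr (a - 2 * s)
          + A2 * moment_mass TYPE('a) s b * R powr (b - 2 * s))"
        using ab A lam \<rho>(1) R rad_ge(1)[OF \<rho>(1), of "x - c"] rad_ge(1)[OF R, of "x - c"]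
        by (intro mult_left_mono add_mono powr_mono2' mult_nonneg_nonneg moment_mass_nonneg) auto
      moreover have "0 \<le> norm (?k *\<^sub>R (x - c)) powr m" by simp
      ultimately show False using test inside by (simp only: mult.assoc)
    qed
  qed
qed

text \<open>At a minimum point of \<open>u + A * rad R powr b\<close> the function
  \<open>l - A * rad R powr b\<close> touches \<open>u\<close> from below. The mean gap near
  \<open>x\<close> is then bounded by curvature and gradient of the perturbation, which supplies the
  hypothesis \<open>average\<close> of the barrier centred at \<open>x\<close>.\<close>

lemma supersolution_minimum:
  fixes x :: 'a
  assumes b: "0 < b" "b < 2 * s" and \<rho>: "0 < \<rho>" and R: "0 < R" and A: "0 < A"
    and min: "\<And>y. l \<le> u y + A * rad R y powr b" "u x + A * rad R x powr b = l"
  shows "lam * (\<rho> powr - (real DIM('a) + 2 * s)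
      * (LINT y|lebesgue. indicator (annulus x \<rho>) y * (u y + A * rad R y powr b - l)))
    \<le> 4 * Lam * A * moment_mass TYPE('a) s b * R powr (b - 2 * s)
      + (A * b * rad R x powr (b - 2) * norm x) powr m"
proof -
  let ?N = "real DIM('a) + 2 * s"
  have s0: "0 < s" using s by linarith
  have sup: "viscosity_supersolution s I (\<lambda>x r p. norm p powr m) UNIV u"
    using sol unfolding viscosity_solution_def by blast
  define \<phi> where "\<phi> y = l + - A * rad R y powr b" for y :: 'a
  have C2: "C2_on UNIV \<phi>"
    unfolding \<phi>_def[abs_def] using C2_on_rad_powr[OF R, of UNIV 0 b]
    by (intro C2_on_add C2_on_const C2_on_cmult) simp
  have cont: "continuous_on UNIV \<phi>" using C2 by (rule C2_on_imp_continuous_on)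
  have touch: "u x = \<phi> x" "\<And>y. \<phi> y \<le> u y"
    using min(2) min(1) by (auto simp: \<phi>_def algebra_simps)
  have grad: "GDERIV \<phi> x :> (- A * b * rad R x powr (b - 2)) *\<^sub>R x"
  proof -
    have "((\<lambda>y. l + - A * rad R (y - 0) powr b) has_derivative
        (\<lambda>h. - A * (b * rad R (x - 0) powr (b - 2) * (h \<bullet> (x - 0))))) (at x)"
      by (rule has_derivative_eq_rhs)
        (rule derivative_intros has_derivative_rad_powr R refl | simp add: fun_eq_iff)+
    then show ?thesis unfolding gderiv_def \<phi>_def[abs_def] by (simp add: algebra_simps)
  qed
  define p where "p z = A * profile R b x z" for z
  have p0: "0 \<le> p z" for z unfolding p_def using A by (simp add: profile_nonneg)
  have diff: "- p z \<le> \<phi> (x + z) + \<phi> (x - z) - 2 * \<phi> x" for z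
  proof -
    have "A * (rad R (x + z) powr b + rad R (x - z) powr b - 2 * rad R x powr b) \<le> p z"
      unfolding p_def using b s A rad_powr_second_difference'[OF R, of b x z 0]
      by (intro mult_left_mono) auto
    then show ?thesis unfolding \<phi>_def by (simp add: algebra_simps)
  qed
  note pb = profile_integral[OF s0 s(2) less_imp_le[OF b(1)] b(2) R, of x]
  have pi: "integrable lebesgue (\<lambda>z. p z * frac_kernel s z)"
    unfolding p_def mult.assoc using pb(1) by simp
  have pI: "Lam / 2 * (LINT z|lebesgue. p z * frac_kernel s z)
      = 4 * Lam * A * moment_mass TYPE('a) s b * rad R x powr (b - 2 * s)"
    unfolding p_def mult.assoc using pb by (simp add: algebra_simps)
  let ?E = "annulus (0::'a) \<rho>"
  have E1: "\<rho> / 4 \<le> norm z" "norm z \<le> \<rho>" if "z \<in> ?E" for z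
    using that by (auto simp: annulus_def)
  have cshift: "continuous_on UNIV (\<lambda>z. u (x + z) - \<phi> (x + z))"
    by (intro continuous_intros continuous_on_compose2[OF cont] continuous_on_compose2[OF continuous_u]) auto
  have q: "integrable lebesgue (\<lambda>z. indicator ?E z * (u (x + z) - \<phi> (x + z)) * frac_kernel s z)"
    using E1(1) \<rho> by (intro integrable_annulus_kernel[OF cshift, of _ "\<rho> / 4"]) auto
  have test: "lam * (LINT z|lebesgue. indicator ?E z * (u (x + z) - \<phi> (x + z)) * frac_kernel s z)
      - Lam / 2 * (LINT z|lebesgue. p z * frac_kernel s z)
      \<le> norm ((- A * b * rad R x powr (b - 2)) *\<^sub>R x) powr m"
    by (rule supersolution_test[OF s lam ell hom sup C2 grad touch, of "\<rho> / 4"])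
      (use \<rho> E1(1) p0 pi q diff in auto)
  have ia: "integrable lebesgue (\<lambda>y. indicator (annulus x \<rho>) y * (u y - \<phi> y))"
    by (intro integrable_indicator_continuous continuous_intros continuous_u cont) auto
  have "(LINT y|lebesgue. indicator (annulus x \<rho>) y * (u y - \<phi> y))
      = (LINT z|lebesgue. indicator (annulus x \<rho>) (x + z) * (u (x + z) - \<phi> (x + z)))"
    using integral_lebesgue_shift[OF borel_measurable_integrable[OF ia], of x] by simp
  also have "\<dots> = (LINT z|lebesgue. indicator ?E z * (u (x + z) - \<phi> (x + z)))"
    by (intro Bochner_Integration.integral_cong) (auto simp: indicator_def annulus_shift)
  finally have sh: "(LINT y|lebesgue. indicator (annulus x \<rho>) y * (u y - \<phi> y))
      = (LINT z|lebesgue. indicator ?E z * (u (x + z) - \<phi> (x + z)))" .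
  have "\<rho> powr - ?N * (LINT y|lebesgue. indicator (annulus x \<rho>) y * (u y - \<phi> y))
      = (LINT z|lebesgue. \<rho> powr - ?N * (indicator ?E z * (u (x + z) - \<phi> (x + z))))"
    unfolding sh by simp
  also have "\<dots> \<le> (LINT z|lebesgue. indicator ?E z * (u (x + z) - \<phi> (x + z)) * frac_kernel s z)"
  proof (rule integral_mono[OF _ q])
    show "integrable lebesgue (\<lambda>z. \<rho> powr - ?N * (indicator ?E z * (u (x + z) - \<phi> (x + z))))"
      by (intro integrable_mult_right integrable_indicator_continuous cshift) auto
    fix z :: 'a
    show "\<rho> powr - ?N * (indicator ?E z * (u (x + z) - \<phi> (x + z)))
        \<le> indicator ?E z * (u (x + z) - \<phi> (x + z)) * frac_kernel s z"
    proof (cases "z \<in> ?E")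
      case True
      have "0 < norm z" using E1(1)[OF True] \<rho> by linarith
      then have "\<rho> powr - ?N \<le> frac_kernel s z"
        unfolding frac_kernel_def using E1(2)[OF True] s0 by (intro powr_mono2') auto
      then have "\<rho> powr - ?N * (u (x + z) - \<phi> (x + z)) \<le> frac_kernel s z * (u (x + z) - \<phi> (x + z))"
        using touch(2)[of "x + z"] by (intro mult_right_mono) auto
      then show ?thesis using True by (simp add: mult.commute)
    qed simp
  qed
  finally have 1: "lam * (\<rho> powr - ?N * (LINT y|lebesgue. indicator (annulus x \<rho>) y * (u y - \<phi> y)))
      \<le> lam * (LINT z|lebesgue. indicator ?E z * (u (x + z) - \<phi> (x + z)) * frac_kernel s z)"
    using lam by (intro mult_left_mono) auto
  have 2: "4 * Lam * A * moment_mass TYPE('a) s b * rad R x powr (b - 2 * s)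
      \<le> 4 * Lam * A * moment_mass TYPE('a) s b * R powr (b - 2 * s)"
    using b A lam R rad_ge(1)[OF R, of x]
    by (intro mult_left_mono powr_mono2' mult_nonneg_nonneg moment_mass_nonneg) auto
  have 3: "norm ((- A * b * rad R x powr (b - 2)) *\<^sub>R x) = A * b * rad R x powr (b - 2) * norm x"
    using A b by (simp add: abs_mult)
  have 4: "u y - \<phi> y = u y + A * rad R y powr b - l" for y
    by (simp add: \<phi>_def)
  show ?thesis using test 1 2 unfolding pI 3 4 by linarith
qed

end

section \<open>Exponents\<close>

text \<open>In the barrier, \<open>k\<close> is the exponent of the inner radius \<open>\<rho> = R powr k\<close> and \<open>a\<close> that of the growth near the
  centre. The bound on \<open>2 * s * k\<close> serves the minimum point of the supersolution, the last two
  inequalities let the gradient win on all scales between \<open>\<rho>\<close> and \<open>R\<close>.\<close>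

lemma critical_exponents:
  fixes s m g :: real
  assumes "1/2 < s" "s < 1" "1 < m" "0 < g" "g < 2 * s" "(m - 2 * s) / (m - 1) < g"
  obtains k a where "k < 1" "2 * s * k + (g - 1) * m < g" "0 < a" "a < g"
    "0 < a * (m - 1) - m + 2 * s" "0 < (g - a) * (m - 1) + k * (a * (m - 1) - m + 2 * s)"
proof -
  have th: "m - 2 * s < g * (m - 1)" using assms by (simp add: divide_less_eq)
  show thesis
  proof (cases "2 * s \<le> m")
    case True
    \<comment> \<open>The critical exponent; \<open>a\<close> is taken slightly above it.\<close>
    define e where "e = (m - 2 * s) / (m - 1)"
    \<comment> \<open>Solves \<open>2 * s * k + (g - 1) * m = g - 2 * s\<close>. Since
      \<open>g\<close> is supercritical, \<open>k\<close> is negative: the inner radius shrinks as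
      \<open>R\<close> grows.\<close>
    define k where "k = (m - (m - 1) * g) / (2 * s) - 1"
    \<comment> \<open>As \<open>k\<close> may be very negative, \<open>\<eta>\<close> is divided by
      \<open>1 + \<bar>k\<bar>\<close>; both \<open>\<eta>\<close> and
      \<open>\<eta> * (1 - k)\<close> then stay below \<open>g - e\<close>, strictly because of the
      factor 2.\<close>
    define \<eta> where "\<eta> = (g - e) / (2 * (1 + \<bar>k\<bar>))"
    have e: "0 \<le> e" "e < g" "e * (m - 1) = m - 2 * s" using assms True by (auto simp: e_def)
    have sk: "2 * s * (k + 1) = m - (m - 1) * g" using assms by (simp add: k_def)
    have \<eta>: "0 < \<eta>" "2 * (\<eta> * (1 + \<bar>k\<bar>)) = g - e"
    proof -
      have k: "0 < 2 * (1 + \<bar>k\<bar>)" by (simp add: add_pos_nonneg)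
      show "0 < \<eta>" unfolding \<eta>_def using e k by (intro divide_pos_pos) auto
      have "\<eta> * (2 * (1 + \<bar>k\<bar>)) = g - e"
        using k nonzero_eq_divide_eq[of "2 * (1 + \<bar>k\<bar>)" \<eta> "g - e"] unfolding \<eta>_def by simp
      then show "2 * (\<eta> * (1 + \<bar>k\<bar>)) = g - e" by linarith
    qed
    have "\<eta> * 1 \<le> \<eta> * (1 + \<bar>k\<bar>)" by (rule mult_left_mono) (use \<eta>(1) in linarith)+
    then have *: "\<eta> < g - e" using \<eta> e by linarith
    have "\<eta> * (1 - k) \<le> \<eta> * (1 + \<bar>k\<bar>)" by (rule mult_left_mono) (use \<eta>(1) in linarith)+
    then have "\<eta> * (1 - k) < g - e" using \<eta> e by linarith
    then have **: "0 < (g - (e + \<eta>)) + k * \<eta>" by (simp add: algebra_simps)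
    have 1: "(e + \<eta>) * (m - 1) - m + 2 * s = \<eta> * (m - 1)" using e(3) by (simp add: algebra_simps)
    show thesis
    proof (rule that[of k "e + \<eta>"])
      have "2 * s * (k + 1) < 2 * s * 1" using sk th by (simp add: algebra_simps)
      then have "k + 1 < 1" using assms by (subst (asm) mult_less_cancel_left_pos) auto
      then show "k < 1" by simp
      show "2 * s * k + (g - 1) * m < g" using sk assms by (simp add: algebra_simps)
      show "0 < e + \<eta>" "e + \<eta> < g" using e \<eta> * by auto
      show "0 < (e + \<eta>) * (m - 1) - m + 2 * s" unfolding 1 using \<eta> assms by simp
      have "(g - (e + \<eta>)) * (m - 1) + k * (\<eta> * (m - 1)) = ((g - (e + \<eta>)) + k * \<eta>) * (m - 1)"
        by (simp add: algebra_simps)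
      then show "0 < (g - (e + \<eta>)) * (m - 1) + k * ((e + \<eta>) * (m - 1) - m + 2 * s)"
        unfolding 1 using ** assms by simp
    qed
  next
    \<comment> \<open>The critical exponent is negative, so \<open>a = g / 2\<close> exceeds it
      already, and a fixed inner radius, \<open>k = 0\<close>, is small enough because
      \<open>(g - 1) * m < g\<close>.\<close>
    case False
    have "(m - 1) * g < (m - 1) * (2 * s)" using assms by simp
    also have "\<dots> < m"
    proof -
      have "m * (2 * s - 1) < 2 * s * (2 * s - 1)" using False assms by (intro mult_strict_right_mono) auto
      also have "\<dots> < 2 * s * 1" using assms by (intro mult_strict_left_mono) auto
      finally show ?thesis by (simp add: algebra_simps)
    qed
    finally have "(m - 1) * g < m" .
    then have 1: "(g - 1) * m < g" by (simp add: algebra_simps)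
    have 2: "0 < g / 2 * (m - 1)" using assms by simp
    show thesis
    proof (rule that[of 0 "g / 2"])
      show "0 < g / 2 * (m - 1) - m + 2 * s" using 2 False by linarith
    qed (use 1 2 assms in simp_all)
  qed
qed

text \<open>The right side divided by \<open>A * w powr (a - 2 * s)\<close> is exactly the bound on
  \<open>Q\<close> in the last hypothesis. For \<open>m > 1\<close> its exponent of \<open>w\<close>
  is positive if and only if \<open>a\<close> exceeds \<open>(m - 2 * s) / (m - 1)\<close>.\<close>

lemma gradient_term_dominates:
  fixes A a w s m Q :: real
  assumes "0 < A" "0 < a" "0 < w"
    and "Q < (a / 2) powr m * (A powr (m - 1) * w powr (a * (m - 1) - m + 2 * s))"
  shows "Q * (A * w powr (a - 2 * s)) < (A * a * w powr (a - 1) / 2) powr m"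
proof -
  have "Q * (A * w powr (a - 2 * s))
      < (a / 2) powr m * (A powr (m - 1) * w powr (a * (m - 1) - m + 2 * s)) * (A * w powr (a - 2 * s))"
    using assms by (intro mult_strict_right_mono) auto
  also have "\<dots> = (a / 2) powr m * (A powr (m - 1) * A powr 1)
      * (w powr (a * (m - 1) - m + 2 * s) * w powr (a - 2 * s))"
    using assms by simp
  also have "\<dots> = (a / 2) powr m * A powr m * w powr ((a - 1) * m)"
    unfolding powr_add[symmetric] by (simp add: algebra_simps)
  also have "\<dots> = (A * (a / 2) * w powr (a - 1)) powr m"
    unfolding powr_mult powr_powr by (simp only: mult_ac)
  finally show ?thesis by simp
qed

lemma eventually_less_powr:
  fixes e c k :: real
  assumes "0 < e" "0 < k"
  shows "eventually (\<lambda>x. c < k * x powr e) at_top"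
proof -
  have "eventually (\<lambda>x. c * x powr - e < k \<and> 0 < x) at_top"
    using assms by (intro eventually_conj eventually_powr_less eventually_gt_at_top) auto
  then show ?thesis
  proof eventually_elim
    case (elim x)
    then have "c * x powr - e * x powr e < k * x powr e" by (intro mult_strict_right_mono) auto
    moreover have "x powr - e * x powr e = 1" using elim by (simp add: powr_add[symmetric])
    ultimately show ?case by (simp add: mult.assoc)
  qed
qed

lemma rad_mono: "0 \<le> t \<Longrightarrow> t \<le> t' \<Longrightarrow> norm x \<le> norm y \<Longrightarrow> rad t x \<le> rad t' y"
  unfolding rad_def by (intro real_sqrt_le_mono add_mono power_mono) auto

lemma rad_le_double: "0 < t \<Longrightarrow> t \<le> norm x \<Longrightarrow> rad t x \<le> 2 * norm x"
  using rad_le[of t x] by linarith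

text \<open>For \<open>norm x \<ge> R\<close> the gradient of each power beats twice its own
  diffusion cost, and the two estimates are averaged. Between \<open>\<rho>\<close> and
  \<open>R\<close> the outer gradient may be weak, so the inner gradient has to pay for both;
  \<open>scale\<close> makes the outer cost comparable to the inner one, whence
  \<open>C1 + 4 * C2\<close>.\<close>

lemma outside_inequality:
  fixes x :: "'a::euclidean_space" and s m a b A1 A2 C1 C2 :: real
  assumes exps: "0 < s" "1 < m" "0 < a" "a < 2 * s" "2 * s < 2" "0 < b" "b < 2 * s"
    and pos: "0 < A1" "0 < A2" "0 \<le> C1" "0 \<le> C2"
    and \<rho>: "0 < \<rho>" "\<rho> \<le> R" "\<rho> \<le> norm x"
    and scale: "A1 * R powr a = A2 * R powr b"
    and ea: "0 < a * (m - 1) - m + 2 * s"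
      "2 * (C1 + 4 * C2) < (a / 2) powr m * (A1 powr (m - 1) * \<rho> powr (a * (m - 1) - m + 2 * s))"
    and eb: "0 < b * (m - 1) - m + 2 * s"
      "2 * C2 < (b / 2) powr m * (A2 powr (m - 1) * R powr (b * (m - 1) - m + 2 * s))"
  shows "C1 * (A1 * rad \<rho> x powr (a - 2 * s)) + C2 * (A2 * rad R x powr (b - 2 * s))
    < (A1 * a * rad \<rho> x powr (a - 2) * norm x + A2 * b * rad R x powr (b - 2) * norm x) powr m"
proof -
  let ?w = "rad \<rho> x" and ?W = "rad R x"
  have R: "0 < R" using \<rho> by linarith
  have w: "0 < ?w" "\<rho> \<le> ?w" "?w \<le> 2 * norm x" and W: "0 < ?W" "R \<le> ?W"
    using \<rho> R rad_pos rad_ge rad_le_double by blast+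
  let ?X = "A1 * a * ?w powr (a - 2) * norm x" and ?Y = "A2 * b * ?W powr (b - 2) * norm x"
  have XY: "0 \<le> ?X" "0 \<le> ?Y" using pos exps by auto
  \<comment> \<open>Smoothing reduces the gradient of a pure power by the factor
    \<open>norm x / v\<close>, at least 1/2 beyond the smoothing length.\<close>
  have half: "v powr (c - 1) / 2 \<le> v powr (c - 2) * norm x" if "0 < v" "v \<le> 2 * norm x" for v c
  proof -
    have "v powr (c - 1) = v powr (c - 2) * v"
      using that(1) powr_add[of v "c - 2" 1] by simp
    also have "\<dots> \<le> v powr (c - 2) * (2 * norm x)" using that by (intro mult_left_mono) auto
    finally show ?thesis by simp
  qed
  have "(C1 + 4 * C2) * 2 * (A1 * ?w powr (a - 2 * s)) < (A1 * a * ?w powr (a - 1) / 2) powr m"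
  proof (rule gradient_term_dominates[OF pos(1) exps(3) w(1)])
    have "\<rho> powr (a * (m - 1) - m + 2 * s) \<le> ?w powr (a * (m - 1) - m + 2 * s)"
      using \<rho> w ea by (intro powr_mono2) auto
    then have "(a / 2) powr m * (A1 powr (m - 1) * \<rho> powr (a * (m - 1) - m + 2 * s))
        \<le> (a / 2) powr m * (A1 powr (m - 1) * ?w powr (a * (m - 1) - m + 2 * s))"
      by (intro mult_left_mono) auto
    then show "(C1 + 4 * C2) * 2 < (a / 2) powr m * (A1 powr (m - 1) * ?w powr (a * (m - 1) - m + 2 * s))"
      using ea(2) by (simp add: mult.commute)
  qed
  also have "\<dots> \<le> (?X + ?Y) powr m"
  proof (rule powr_mono2)
    have "A1 * a * (?w powr (a - 1) / 2) \<le> A1 * a * (?w powr (a - 2) * norm x)"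
      using half[OF w(1,3), of a] pos exps by (intro mult_left_mono) auto
    then show "A1 * a * ?w powr (a - 1) / 2 \<le> ?X + ?Y" using XY by (simp add: mult.assoc)
  qed (use pos exps in auto)
  finally have 1: "2 * ((C1 + 4 * C2) * (A1 * ?w powr (a - 2 * s))) < (?X + ?Y) powr m"
    by (simp only: mult.commute[of _ 2] mult.assoc)
  have aw: "0 \<le> A1 * ?w powr (a - 2 * s)" using pos by simp
  show ?thesis
  proof (cases "R \<le> norm x")
    case True
    have W2: "?W \<le> 2 * norm x" using rad_le_double[OF R True] .
    have "2 * C2 * (A2 * ?W powr (b - 2 * s)) < (A2 * b * ?W powr (b - 1) / 2) powr m"
    proof (rule gradient_term_dominates[OF pos(2) exps(6) W(1)])
      have "R powr (b * (m - 1) - m + 2 * s) \<le> ?W powr (b * (m - 1) - m + 2 * s)"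
        using R W eb by (intro powr_mono2) auto
      then have "(b / 2) powr m * (A2 powr (m - 1) * R powr (b * (m - 1) - m + 2 * s))
          \<le> (b / 2) powr m * (A2 powr (m - 1) * ?W powr (b * (m - 1) - m + 2 * s))"
        by (intro mult_left_mono) auto
      then show "2 * C2 < (b / 2) powr m * (A2 powr (m - 1) * ?W powr (b * (m - 1) - m + 2 * s))"
        using eb(2) by linarith
    qed
    also have "\<dots> \<le> (?X + ?Y) powr m"
    proof (rule powr_mono2)
      have "A2 * b * (?W powr (b - 1) / 2) \<le> A2 * b * (?W powr (b - 2) * norm x)"
        using half[OF W(1) W2, of b] pos exps by (intro mult_left_mono) auto
      then show "A2 * b * ?W powr (b - 1) / 2 \<le> ?X + ?Y" using XY by (simp add: mult.assoc)
    qed (use pos exps in auto)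
    finally have 2: "2 * (C2 * (A2 * ?W powr (b - 2 * s))) < (?X + ?Y) powr m" by (simp add: mult_ac)
    have "C1 * (A1 * ?w powr (a - 2 * s)) \<le> (C1 + 4 * C2) * (A1 * ?w powr (a - 2 * s))"
      using aw pos by (intro mult_right_mono) auto
    then show ?thesis using 1 2 by linarith
  next
    \<comment> \<open>The 4 arises from \<open>?w \<le> 2 * R\<close> and
      \<open>2 powr (a - 2 * s) \<ge> 1 / 4\<close>; \<open>scale\<close> identifies the two costs
      at distance \<open>R\<close>.\<close>
    case False
    have "?w \<le> 2 * R" using rad_le[OF \<rho>(1), of x] \<rho> False by linarith
    then have "(2 * R) powr (a - 2 * s) \<le> ?w powr (a - 2 * s)"
      using w exps by (intro powr_mono2') auto
    then have "4 * (A1 * (2 * R) powr (a - 2 * s)) \<le> 4 * (A1 * ?w powr (a - 2 * s))"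
      using pos by simp
    moreover have "A2 * ?W powr (b - 2 * s) \<le> A2 * R powr (b - 2 * s)"
      using W R exps pos by (intro mult_left_mono powr_mono2') auto
    moreover have "A2 * R powr (b - 2 * s) = A1 * R powr (a - 2 * s)"
      using scale R by (simp add: powr_diff)
    moreover have "A1 * R powr (a - 2 * s) \<le> 4 * (A1 * (2 * R) powr (a - 2 * s))"
    proof -
      have "2 powr (-2) \<le> (2::real) powr (a - 2 * s)" using exps by (intro powr_mono) auto
      then have "1 \<le> 4 * (2::real) powr (a - 2 * s)" by (simp add: powr_minus)
      then have "A1 * R powr (a - 2 * s) * 1 \<le> A1 * R powr (a - 2 * s) * (4 * 2 powr (a - 2 * s))"
        using pos by (intro mult_left_mono) auto
      then show ?thesis by (simp add: powr_mult mult_ac)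
    qed
    ultimately have "A2 * ?W powr (b - 2 * s) \<le> 4 * (A1 * ?w powr (a - 2 * s))" by linarith
    then have "C2 * (A2 * ?W powr (b - 2 * s)) \<le> C2 * (4 * (A1 * ?w powr (a - 2 * s)))"
      using pos by (intro mult_left_mono) auto
    then have "C1 * (A1 * ?w powr (a - 2 * s)) + C2 * (A2 * ?W powr (b - 2 * s))
        \<le> (C1 + 4 * C2) * (A1 * ?w powr (a - 2 * s))"
      by (simp add: algebra_simps)
    moreover have "0 \<le> (C1 + 4 * C2) * (A1 * ?w powr (a - 2 * s))" using aw pos by simp
    ultimately show ?thesis using 1 by linarith
  qed
qed

section \<open>Asymptotics\<close>

context viscosity_HJ
begin

text \<open>The threshold for \<open>R\<close> depends on exponents and constants only, so the
  estimate is uniform in \<open>c\<close>, \<open>l\<close> and \<open>J\<close>. This matters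
  because the centre used for the lower bound moves with \<open>R\<close>.\<close>

lemma asymptotic_barrier:
  assumes growth: "\<And>y::'a. \<bar>u y\<bar> \<le> M * (1 + norm y) powr g" and g: "0 < g" "g < 2 * s" "m - 2 * s < g * (m - 1)"
    and k: "k < 1" and a: "0 < a" "a < g"
    and ea: "0 < a * (m - 1) - m + 2 * s" "0 < (g - a) * (m - 1) + k * (a * (m - 1) - m + 2 * s)"
    and \<epsilon>: "0 < \<epsilon>"
  shows "eventually (\<lambda>R. \<forall>(c::'a) l J y.
      (LINT y|lebesgue. indicator (annulus c (R powr k)) y * max 0 (u y - l))
        \<le> 1 / 4 * (\<epsilon> * R powr g) * measure lebesgue (ball c (R powr k)) \<longrightarrow>
      1 \<le> J \<longrightarrow> norm (y - c) \<le> J * R \<longrightarrow> u y \<le> l + 8 * \<epsilon> * J\<^sup>2 * R powr g) at_top"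
proof -
  define b where "b = (g + 2 * s) / 2"
  have b: "0 < b" "g < b" "b < 2 * s" using g s by (auto simp: b_def)
  let ?n = "real DIM('a)"
  define C1 where "C1 = 4 * Lam * moment_mass TYPE('a) s a"
  define C2 where "C2 = 4 * Lam * moment_mass TYPE('a) s b"
  have C: "0 \<le> C1" "0 \<le> C2" using lam by (auto simp: C1_def C2_def intro!: mult_nonneg_nonneg moment_mass_nonneg)
  define \<omega> where "\<omega> = measure lebesgue (ball (0::'a) 1)"
  \<comment> \<open>The nonlocal gain will be \<open>2 * q * Z\<close>, so each of the two diffusion
    costs is allowed \<open>q * Z\<close>.\<close>
  define q where "q = lam * 2 powr - (?n + 2 * s) * \<omega> / 8"
  have \<omega>: "0 < \<omega>" unfolding \<omega>_def by (rule measure_ball_pos) simp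
  have q: "0 < q" unfolding q_def using lam \<omega> by (intro divide_pos_pos mult_pos_pos) auto
  have eb: "0 < b * (m - 1) - m + 2 * s"
  proof -
    have "g * (m - 1) < b * (m - 1)" using b m by simp
    then show ?thesis using g by linarith
  qed
  have M: "0 \<le> M" using growth by (rule growth_constant_nonneg)
  \<comment> \<open>The two decay conditions exclude contact near the centre, the two growth
    conditions contact away from it.\<close>
  have "eventually (\<lambda>R. 1 \<le> R \<and> C1 * R powr ((k - 1) * a) < q \<and> C2 * R powr ((k - 1) * (2 * s)) < q
     \<and> 2 * (C1 + 4 * C2) < ((a / 2) powr m * \<epsilon> powr (m - 1)) * R powr ((g - a) * (m - 1) + k * (a * (m - 1) - m + 2 * s))
     \<and> 2 * C2 < ((b / 2) powr m * \<epsilon> powr (m - 1)) * R powr (g * (m - 1) - m + 2 * s)) at_top"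
  proof (intro eventually_conj eventually_powr_less eventually_less_powr eventually_ge_at_top)
    show "(k - 1) * a < 0" using k a by (intro mult_neg_pos) auto
    show "(k - 1) * (2 * s) < 0" using k s by (intro mult_neg_pos) auto
  qed (use q \<epsilon> a b ea g in auto)
  then show ?thesis
  proof (eventually_elim, intro allI impI)
    fix R c l J y
    assume E: "1 \<le> R \<and> C1 * R powr ((k - 1) * a) < q \<and> C2 * R powr ((k - 1) * (2 * s)) < q
     \<and> 2 * (C1 + 4 * C2) < ((a / 2) powr m * \<epsilon> powr (m - 1)) * R powr ((g - a) * (m - 1) + k * (a * (m - 1) - m + 2 * s))
     \<and> 2 * C2 < ((b / 2) powr m * \<epsilon> powr (m - 1)) * R powr (g * (m - 1) - m + 2 * s)"
      and average: "(LINT y|lebesgue. indicator (annulus c (R powr k)) y * max 0 (u y - l))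
        \<le> 1 / 4 * (\<epsilon> * R powr g) * measure lebesgue (ball (c::'a) (R powr k))"
      and J: "1 \<le> J" and y: "norm (y - c) \<le> J * R"
    define \<rho> where "\<rho> = R powr k"
    \<comment> \<open>Both powers are normalized to \<open>\<epsilon> * R powr g\<close> at distance
      \<open>R\<close>.\<close>
    define A1 where "A1 = \<epsilon> * R powr (g - a)"
    define A2 where "A2 = \<epsilon> * R powr (g - b)"
    have R: "0 < R" "1 \<le> R" using E by auto
    have \<rho>: "0 < \<rho>" "\<rho> \<le> R" using R k powr_mono[of k 1 R] by (auto simp: \<rho>_def)
    have A: "0 < A1" "0 < A2" using \<epsilon> R by (auto simp: A1_def A2_def)
    have A1R: "A1 * R powr a = \<epsilon> * R powr g" and A2R: "A2 * R powr b = \<epsilon> * R powr g"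
      by (simp_all add: A1_def A2_def powr_add[symmetric])
    have barrier: "u y \<le> l + A1 * rad \<rho> (y - c) powr a + A2 * rad R (y - c) powr b"
    proof (rule subsolution_barrier[where M = M and g = g])
      show "u y \<le> M * (1 + norm y) powr g" for y using growth[of y] by linarith
      show "(LINT y|lebesgue. indicator (annulus c \<rho>) y * max 0 (u y - l))
          \<le> 1 / 4 * (A2 * R powr b) * measure lebesgue (ball c \<rho>)"
        unfolding A2R using average unfolding \<rho>_def .
      \<comment> \<open>The common unit \<open>R powr g * \<rho> powr (- 2 * s)\<close>; relative to
        it the two costs decay because \<open>k < 1\<close>.\<close>
      define Z where "Z = \<epsilon> * R powr (g - 2 * s * k)"
      have Z: "0 < Z" using \<epsilon> R by (simp add: Z_def)
      have "measure lebesgue (ball c \<rho>) = \<rho> powr ?n * \<omega>"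
        using \<rho> content_ball_conv_unit_ball[of \<rho> c] by (simp add: \<omega>_def powr_realpow)
      then have "lam * (2 * \<rho>) powr - (?n + 2 * s) * (1 / 4 * (A2 * R powr b) * measure lebesgue (ball c \<rho>))
          = 2 * q * (\<epsilon> * R powr g * (\<rho> powr - (?n + 2 * s) * \<rho> powr ?n))"
        unfolding A2R q_def powr_mult by simp
      also have "\<epsilon> * R powr g * (\<rho> powr - (?n + 2 * s) * \<rho> powr ?n) = Z"
        unfolding Z_def \<rho>_def powr_powr mult.assoc powr_add[symmetric] by (simp add: algebra_simps)
      finally have 1: "lam * (2 * \<rho>) powr - (?n + 2 * s) * (1 / 4 * (A2 * R powr b) * measure lebesgue (ball c \<rho>))
          = 2 * q * Z" .
      have 2: "A1 * \<rho> powr (a - 2 * s) = Z * R powr ((k - 1) * a)"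
        unfolding A1_def Z_def \<rho>_def powr_powr mult.assoc powr_add[symmetric] by (simp add: algebra_simps)
      have 3: "A2 * R powr (b - 2 * s) = Z * R powr ((k - 1) * (2 * s))"
        unfolding A2_def Z_def mult.assoc powr_add[symmetric] by (simp add: algebra_simps)
      have "4 * Lam * (A1 * moment_mass TYPE('a) s a * \<rho> powr (a - 2 * s)
          + A2 * moment_mass TYPE('a) s b * R powr (b - 2 * s))
        = C1 * (A1 * \<rho> powr (a - 2 * s)) + C2 * (A2 * R powr (b - 2 * s))"
        unfolding C1_def C2_def by (simp only: distrib_left mult_ac)
      also have "\<dots> = C1 * (Z * R powr ((k - 1) * a)) + C2 * (Z * R powr ((k - 1) * (2 * s)))"
        unfolding 2 3 ..
      also have "\<dots> = (C1 * R powr ((k - 1) * a) + C2 * R powr ((k - 1) * (2 * s))) * Z"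
        by (simp add: algebra_simps)
      also have "\<dots> < 2 * q * Z"
        using E Z by (intro mult_strict_right_mono) auto
      finally show "4 * Lam * (A1 * moment_mass TYPE('a) s a * \<rho> powr (a - 2 * s)
          + A2 * moment_mass TYPE('a) s b * R powr (b - 2 * s))
        < lam * (2 * \<rho>) powr - (?n + 2 * s) * (1 / 4 * (A2 * R powr b) * measure lebesgue (ball c \<rho>))"
        unfolding 1 .
      fix x :: 'a assume x: "\<rho> \<le> norm x"
      have "C1 * (A1 * rad \<rho> x powr (a - 2 * s)) + C2 * (A2 * rad R x powr (b - 2 * s))
        < (A1 * a * rad \<rho> x powr (a - 2) * norm x + A2 * b * rad R x powr (b - 2) * norm x) powr m"
      proof (rule outside_inequality[OF _ m a(1) _ _ b(1,3) A C \<rho> x])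
        show "A1 * R powr a = A2 * R powr b" unfolding A1R A2R ..
        have "A1 powr (m - 1) * \<rho> powr (a * (m - 1) - m + 2 * s)
            = \<epsilon> powr (m - 1) * R powr ((g - a) * (m - 1) + k * (a * (m - 1) - m + 2 * s))"
          unfolding A1_def \<rho>_def powr_mult powr_powr mult.assoc powr_add[symmetric] ..
        then show "2 * (C1 + 4 * C2) < (a / 2) powr m * (A1 powr (m - 1) * \<rho> powr (a * (m - 1) - m + 2 * s))"
          using E by (simp only: mult.assoc)
        have "A2 powr (m - 1) * R powr (b * (m - 1) - m + 2 * s) = \<epsilon> powr (m - 1) * R powr (g * (m - 1) - m + 2 * s)"
          unfolding A2_def powr_mult powr_powr mult.assoc powr_add[symmetric] by (simp add: algebra_simps)
        then show "2 * C2 < (b / 2) powr m * (A2 powr (m - 1) * R powr (b * (m - 1) - m + 2 * s))"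
          using E by (simp only: mult.assoc)
      qed (use s g a eb ea in auto)
      then show "4 * Lam * (A1 * moment_mass TYPE('a) s a * rad \<rho> x powr (a - 2 * s)
          + A2 * moment_mass TYPE('a) s b * rad R x powr (b - 2 * s))
        < (A1 * a * rad \<rho> x powr (a - 2) * norm x + A2 * b * rad R x powr (b - 2) * norm x) powr m"
        unfolding C1_def C2_def by (simp only: distrib_left mult_ac)
    qed (use M g a b \<rho> A in auto)
    have far: "rad R (y - c) \<le> 2 * J * R" "rad \<rho> (y - c) \<le> 2 * J * R"
    proof -
      have "1 * R \<le> J * R" using J R by (intro mult_right_mono) auto
      then show 1: "rad R (y - c) \<le> 2 * J * R" using rad_le[OF R(1), of "y - c"] y by linarith
      show "rad \<rho> (y - c) \<le> 2 * J * R"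
        using rad_mono[of \<rho> R "y - c" "y - c"] \<rho> 1 by linarith
    qed
    \<comment> \<open>With \<open>e \<le> 2\<close> and \<open>J \<ge> 1\<close>,
      \<open>(2 * J) powr e \<le> 4 * J\<^sup>2\<close>; two such terms give the 8 of the
      conclusion.\<close>
    have scaled: "\<epsilon> * R powr (g - e) * v powr e \<le> 4 * \<epsilon> * J\<^sup>2 * R powr g"
      if "0 < v" "v \<le> 2 * J * R" "0 < e" "e \<le> 2" for v e
    proof -
      have "v powr e \<le> (2 * J * R) powr e" using that by (intro powr_mono2) auto
      also have "\<dots> = (2 * J) powr e * R powr e" by (simp add: powr_mult)
      also have "\<dots> \<le> (2 * J) powr 2 * R powr e"
        using J that by (intro mult_right_mono powr_mono) auto
      also have "\<dots> = 4 * J\<^sup>2 * R powr e" using J by (simp add: power_mult_distrib)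
      finally have "\<epsilon> * R powr (g - e) * v powr e \<le> \<epsilon> * R powr (g - e) * (4 * J\<^sup>2 * R powr e)"
        using \<epsilon> by (intro mult_left_mono) auto
      also have "\<dots> = 4 * \<epsilon> * J\<^sup>2 * (R powr (g - e) * R powr e)" by (simp only: mult_ac)
      also have "R powr (g - e) * R powr e = R powr g" by (simp add: powr_add[symmetric])
      finally show ?thesis .
    qed
    have "A1 * rad \<rho> (y - c) powr a \<le> 4 * \<epsilon> * J\<^sup>2 * R powr g"
      unfolding A1_def using far a g s rad_pos[OF \<rho>(1)] by (intro scaled) auto
    moreover have "A2 * rad R (y - c) powr b \<le> 4 * \<epsilon> * J\<^sup>2 * R powr g"
      unfolding A2_def using far b s rad_pos[OF R(1)] by (intro scaled) auto
    ultimately show "u y \<le> l + 8 * \<epsilon> * J\<^sup>2 * R powr g" using barrier by linarith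
  qed
qed

text \<open>Since \<open>k < 1\<close>, the growth bound alone makes \<open>u\<close> of lower order
  than \<open>R powr g\<close> on the ball of radius \<open>R powr k\<close> around the origin, so
  the mean condition holds there.\<close>

lemma eventually_upper_bound:
  assumes growth: "\<And>y::'a. \<bar>u y\<bar> \<le> M * (1 + norm y) powr g" and g: "0 < g" "g < 2 * s"
    "(m - 2 * s) / (m - 1) < g"
    and \<delta>: "0 < \<delta>"
  shows "eventually (\<lambda>R. \<forall>x::'a. norm x = R \<longrightarrow> u x < \<delta> * R powr g) at_top"
proof -
  have th: "m - 2 * s < g * (m - 1)" using g m by (simp add: divide_less_eq)
  obtain k a where k: "k < 1" and a: "0 < a" "a < g"
    and ea: "0 < a * (m - 1) - m + 2 * s" "0 < (g - a) * (m - 1) + k * (a * (m - 1) - m + 2 * s)"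
    by (rule critical_exponents[OF s m g]) blast
  define \<epsilon> where "\<epsilon> = \<delta> / 16"
  have \<epsilon>: "0 < \<epsilon>" using \<delta> by (simp add: \<epsilon>_def)
  \<comment> \<open>\<open>R powr k\<close> may tend to 0; the larger exponent makes
    \<open>R powr k' \<ge> 1\<close>, which absorbs the 1 in \<open>1 + norm y\<close>.\<close>
  define k' where "k' = max k (1 / 2)"
  have k': "k \<le> k'" "0 < k'" "k' < 1" using k by (auto simp: k'_def)
  have M: "0 \<le> M" using growth by (rule growth_constant_nonneg)
  have "(k' - 1) * g < 0" using k' g by (intro mult_neg_pos) auto
  then have "eventually (\<lambda>R. M * 2 powr g * R powr ((k' - 1) * g) < \<epsilon> / 4) at_top"
    using \<epsilon> by (intro eventually_powr_less) auto
  with asymptotic_barrier[OF growth g(1,2) th k a ea \<epsilon>] eventually_ge_at_top[of 1]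
  show ?thesis
  proof (eventually_elim, intro allI impI)
    fix R :: real and x :: 'a
    assume barrier: "\<forall>(c::'a) l J y.
      (LINT y|lebesgue. indicator (annulus c (R powr k)) y * max 0 (u y - l))
        \<le> 1 / 4 * (\<epsilon> * R powr g) * measure lebesgue (ball c (R powr k)) \<longrightarrow>
      1 \<le> J \<longrightarrow> norm (y - c) \<le> J * R \<longrightarrow> u y \<le> l + 8 * \<epsilon> * J\<^sup>2 * R powr g"
      and R: "1 \<le> R" and small: "M * 2 powr g * R powr ((k' - 1) * g) < \<epsilon> / 4"
      and x: "norm x = R"
    let ?B = "ball (0::'a) (R powr k)"
    have up: "max 0 (u y - 0) \<le> 1 / 4 * (\<epsilon> * R powr g)" if "y \<in> ?B" for y
    proof -
      have "1 \<le> R powr k'" using R k' by (simp add: ge_one_powr_ge_zero)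
      moreover have "R powr k \<le> R powr k'" using R k' by (intro powr_mono) auto
      ultimately have "1 + norm y \<le> 2 * R powr k'" using that by simp
      then have "(1 + norm y) powr g \<le> (2 * R powr k') powr g" using g by (intro powr_mono2) auto
      also have "\<dots> = 2 powr g * R powr ((k' - 1) * g) * R powr g"
        unfolding powr_mult powr_powr mult.assoc powr_add[symmetric] by (simp add: algebra_simps)
      finally have "M * (1 + norm y) powr g \<le> M * (2 powr g * R powr ((k' - 1) * g) * R powr g)"
        using M by (rule mult_left_mono)
      also have "\<dots> = (M * 2 powr g * R powr ((k' - 1) * g)) * R powr g" by (simp only: mult_ac)
      also have "\<dots> \<le> \<epsilon> / 4 * R powr g" using small by (intro mult_right_mono) auto
      finally have "u y \<le> 1 / 4 * (\<epsilon> * R powr g)" using growth[of y] by simp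
      moreover have "0 \<le> 1 / 4 * (\<epsilon> * R powr g)" using \<epsilon> by simp
      ultimately show ?thesis by simp
    qed
    have "(LINT y|lebesgue. indicator (annulus 0 (R powr k)) y * max 0 (u y - 0))
        \<le> (LINT y|lebesgue. indicator ?B y * (1 / 4 * (\<epsilon> * R powr g)))"
    proof (rule integral_mono)
      show "integrable lebesgue (\<lambda>y. indicator (annulus 0 (R powr k)) y * max 0 (u y - 0))"
        by (intro integrable_indicator_continuous continuous_intros continuous_u) auto
      show "integrable lebesgue (\<lambda>y. indicator ?B y * (1 / 4 * (\<epsilon> * R powr g)))"
        by (intro integrable_indicator_continuous continuous_intros) auto
      show "indicator (annulus 0 (R powr k)) y * max 0 (u y - 0) \<le> indicator ?B y * (1 / 4 * (\<epsilon> * R powr g))" for y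
        using up[of y] \<epsilon> unfolding indicator_def annulus_def by auto
    qed
    also have "\<dots> = 1 / 4 * (\<epsilon> * R powr g) * measure lebesgue ?B" by simp
    finally have "u x \<le> 0 + 8 * \<epsilon> * 1\<^sup>2 * R powr g"
      using barrier[rule_format, of 0 0 1 x] x by simp
    also have "\<dots> < \<delta> * R powr g" using \<delta> R by (simp add: \<epsilon>_def)
    finally show "u x < \<delta> * R powr g" .
  qed
qed

text \<open>A low value says nothing by itself about the mean around it. At a perturbed minimum it
  does: the gradient of the perturbation is only of order \<open>R powr (g - 1)\<close>, and
  \<open>k\<close> is small enough for the nonlocal term on scale \<open>R powr k\<close> to
  dominate its power \<open>m\<close>.\<close>

lemma eventually_lower_bound:
  assumes growth: "\<And>y::'a. \<bar>u y\<bar> \<le> M * (1 + norm y) powr g" and g: "0 < g" "g < 2 * s"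
    "(m - 2 * s) / (m - 1) < g"
    and \<delta>: "0 < \<delta>"
  shows "eventually (\<lambda>R. \<forall>x::'a. norm x = R \<longrightarrow> - (\<delta> * R powr g) < u x) at_top"
proof -
  have th: "m - 2 * s < g * (m - 1)" using g m by (simp add: divide_less_eq)
  obtain k a where k: "k < 1" "2 * s * k + (g - 1) * m < g" and a: "0 < a" "a < g"
    and ea: "0 < a * (m - 1) - m + 2 * s" "0 < (g - a) * (m - 1) + k * (a * (m - 1) - m + 2 * s)"
    by (rule critical_exponents[OF s m g])
  define b where "b = (g + 2 * s) / 2"
  have b: "0 < b" "g < b" "b < 2 * s" using g s by (auto simp: b_def)
  have M: "0 \<le> M" using growth by (rule growth_constant_nonneg)
  let ?n = "real DIM('a)"
  \<comment> \<open>Bounds \<open>norm z / R\<close> for the minimum point \<open>z\<close> chosen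
    later, by solving \<open>\<delta> / 8 * (norm z / R) powr (b - g) \<le> M * 2 powr g\<close>. It
    is independent of \<open>R\<close>, so \<open>\<epsilon>\<close> may depend on it.\<close>
  define J where "J = max 1 ((8 * (M * 2 powr g) / \<delta>) powr (1 / (b - g)))"
  have J: "1 \<le> J" by (simp add: J_def)
  \<comment> \<open>Makes the excess \<open>8 * \<epsilon> * J\<^sup>2\<close> equal to
    \<open>\<delta> / 4\<close>, half the depth of the base level.\<close>
  define \<epsilon> where "\<epsilon> = \<delta> / (32 * J\<^sup>2)"
  have \<epsilon>: "0 < \<epsilon>" using \<delta> J by (simp add: \<epsilon>_def)
  define \<omega> where "\<omega> = measure lebesgue (ball (0::'a) 1)"
  have \<omega>: "0 < \<omega>" unfolding \<omega>_def by (rule measure_ball_pos) simp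
  define D1 where "D1 = 4 * Lam * (\<delta> / 8) * moment_mass TYPE('a) s b"
  define D2 where "D2 = (\<delta> / 8 * b * J) powr m"
  have "eventually (\<lambda>R. D1 * R powr ((k - 1) * (2 * s)) < lam * (1 / 4 * \<epsilon> * \<omega>) / 2
      \<and> D2 * R powr (2 * s * k + (g - 1) * m - g) < lam * (1 / 4 * \<epsilon> * \<omega>) / 2
      \<and> 4 * M / \<delta> < 1 * R powr g \<and> 1 \<le> R) at_top"
  proof (intro eventually_conj eventually_powr_less eventually_less_powr eventually_ge_at_top)
    show "(k - 1) * (2 * s) < 0" using k s by (intro mult_neg_pos) auto
  qed (use k lam \<epsilon> \<omega> g in auto)
  with asymptotic_barrier[OF growth g(1,2) th k(1) a ea \<epsilon>]
  show ?thesis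
  proof (eventually_elim, intro allI impI)
    fix R :: real and x :: 'a
    assume barrier: "\<forall>(c::'a) l J y.
      (LINT y|lebesgue. indicator (annulus c (R powr k)) y * max 0 (u y - l))
        \<le> 1 / 4 * (\<epsilon> * R powr g) * measure lebesgue (ball c (R powr k)) \<longrightarrow>
      1 \<le> J \<longrightarrow> norm (y - c) \<le> J * R \<longrightarrow> u y \<le> l + 8 * \<epsilon> * J\<^sup>2 * R powr g"
      and E: "D1 * R powr ((k - 1) * (2 * s)) < lam * (1 / 4 * \<epsilon> * \<omega>) / 2
      \<and> D2 * R powr (2 * s * k + (g - 1) * m - g) < lam * (1 / 4 * \<epsilon> * \<omega>) / 2
      \<and> 4 * M / \<delta> < 1 * R powr g \<and> 1 \<le> R"
      and x: "norm x = R"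
    have R: "0 < R" "1 \<le> R" using E by auto
    define \<rho> where "\<rho> = R powr k"
    have \<rho>: "0 < \<rho>" using R by (simp add: \<rho>_def)
    \<comment> \<open>At distance \<open>R\<close> the perturbation is at most
      \<open>4 * (\<delta> / 8) * R powr g\<close>, so half of the supposed depth survives in the
      minimum value \<open>l\<close>.\<close>
    define A where "A = \<delta> / 8 * R powr (g - b)"
    have A: "0 < A" using \<delta> R by (simp add: A_def)
    have AR: "A * R powr b = \<delta> / 8 * R powr g"
      by (simp add: A_def powr_add[symmetric])
    show "- (\<delta> * R powr g) < u x"
    proof (rule ccontr)
      assume neg: "\<not> ?thesis"
      obtain z where z: "\<And>y. - u y - A * rad R (y - 0) powr b \<le> - u z - A * rad R (z - 0) powr b"
      proof (rule maximum_attained[of "\<lambda>y. - u y" M g "\<lambda>y. A * rad R (y - 0) powr b" A 0 b 0])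
        show "- u y \<le> M * (1 + norm y) powr g" for y using growth[of y] by linarith
        show "A * norm (y - 0) powr b + 0 \<le> A * rad R (y - 0) powr b" for y
          using rad_ge(2)[of y R] b A by (simp add: powr_mono2)
        show "continuous_on UNIV (\<lambda>y. A * rad R (y - 0) powr b)"
          by (intro continuous_intros continuous_on_rad_powr R)
      qed (use M A g b in \<open>auto intro!: continuous_intros continuous_u\<close>)
      define l where "l = u z + A * rad R z powr b"
      have min: "l \<le> u y + A * rad R y powr b" for y
        using z[of y] unfolding l_def by simp
      have "A * rad R x powr b \<le> A * (2 * R) powr b"
        using rad_le[OF R(1), of x] x rad_pos[OF R(1), of x] b A by (intro mult_left_mono powr_mono2) auto
      also have "\<dots> = 2 powr b * (A * R powr b)" by (simp add: powr_mult)
      also have "\<dots> \<le> 2 powr 2 * (A * R powr b)"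
        using b s A by (intro mult_right_mono powr_mono) auto
      finally have "A * rad R x powr b \<le> \<delta> / 2 * R powr g" unfolding AR by simp
      then have l: "l \<le> - (\<delta> / 2 * R powr g)" using min[of x] neg by linarith
      have zJ: "norm z \<le> J * R"
      proof (cases "norm z \<le> R")
        case True
        then show ?thesis using J R mult_right_mono[of 1 J R] by linarith
      next
        case False
        then have zp: "0 < norm z" "1 \<le> norm z" using R by auto
        have "\<delta> / 8 * R powr (g - b) * norm z powr b \<le> A * rad R z powr b"
          unfolding A_def using rad_ge(2)[of z R] b \<delta> by (intro mult_left_mono powr_mono2) auto
        also have "\<dots> \<le> - u z"
        proof -
          have "0 \<le> \<delta> / 2 * R powr g" using \<delta> by simp
          then show ?thesis using l unfolding l_def by linarith
        qed
        also have "\<dots> \<le> M * (1 + norm z) powr g" using growth[of z] by linarith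
        also have "\<dots> \<le> M * (2 * norm z) powr g"
          using zp M g by (intro mult_left_mono powr_mono2) auto
        finally have "\<delta> * (R powr (g - b) * norm z powr b) \<le> 8 * (M * 2 powr g) * norm z powr g"
          by (simp add: powr_mult mult_ac)
        then have "\<delta> * (R powr (g - b) * norm z powr b) * norm z powr (- g) \<le> 8 * (M * 2 powr g) * norm z powr g * norm z powr (- g)"
          by (rule mult_right_mono) simp
        moreover have "norm z powr g * norm z powr (- g) = 1" using zp by (simp add: powr_add[symmetric])
        moreover have "R powr (g - b) * norm z powr b * norm z powr (- g) = (norm z / R) powr (b - g)"
        proof -
          have "R powr (g - b) = 1 / R powr (b - g)"
            by (metis minus_diff_eq powr_minus_divide)
          moreover have "norm z powr b * norm z powr (- g) = norm z powr (b - g)"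
            by (simp add: powr_add[symmetric])
          ultimately show ?thesis by (simp add: powr_divide mult.assoc)
        qed
        ultimately have "\<delta> * (norm z / R) powr (b - g) \<le> 8 * (M * 2 powr g)"
          by (simp add: mult.assoc)
        then have "(norm z / R) powr (b - g) \<le> 8 * (M * 2 powr g) / \<delta>"
          using \<delta> by (simp add: pos_le_divide_eq mult.commute)
        then have "((norm z / R) powr (b - g)) powr (1 / (b - g)) \<le> (8 * (M * 2 powr g) / \<delta>) powr (1 / (b - g))"
          using b by (intro powr_mono2) auto
        then have "norm z / R \<le> J"
          using b zp R unfolding powr_powr J_def by simp
        then show ?thesis using R by (simp add: divide_le_eq)
      qed
      let ?int = "LINT y|lebesgue. indicator (annulus z \<rho>) y * (u y + A * rad R y powr b - l)"
      have 1: "lam * (\<rho> powr - (?n + 2 * s) * ?int)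
        \<le> 4 * Lam * A * moment_mass TYPE('a) s b * R powr (b - 2 * s) + (A * b * rad R z powr (b - 2) * norm z) powr m"
        by (rule supersolution_minimum[OF b(1,3) \<rho> R(1) A min]) (simp add: l_def)
      have 2: "4 * Lam * A * moment_mass TYPE('a) s b * R powr (b - 2 * s) = D1 * R powr (g - 2 * s)"
      proof -
        have "A * R powr (b - 2 * s) = \<delta> / 8 * R powr (g - 2 * s)"
          unfolding A_def mult.assoc powr_add[symmetric] by simp
        moreover have "4 * Lam * A * moment_mass TYPE('a) s b * R powr (b - 2 * s)
            = 4 * Lam * moment_mass TYPE('a) s b * (A * R powr (b - 2 * s))"
          by (simp only: mult_ac)
        ultimately show ?thesis unfolding D1_def by (simp only: mult_ac)
      qed
      have "(A * b * rad R z powr (b - 2) * norm z) powr m \<le> (\<delta> / 8 * b * J * R powr (g - 1)) powr m"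
      proof (rule powr_mono2)
        have "rad R z powr (b - 2) * norm z \<le> R powr (b - 2) * (J * R)"
          using zJ R b s rad_ge(1)[OF R(1), of z] by (intro mult_mono powr_mono2') auto
        then have "A * b * (rad R z powr (b - 2) * norm z) \<le> A * b * (R powr (b - 2) * (J * R))"
          using A b by (intro mult_left_mono) auto
        also have "\<dots> = \<delta> / 8 * b * J * (R powr (g - b) * R powr (b - 2) * R powr 1)"
          unfolding A_def using R by simp
        also have "R powr (g - b) * R powr (b - 2) * R powr 1 = R powr (g - 1)"
          unfolding powr_add[symmetric] by (simp add: algebra_simps)
        finally show "A * b * rad R z powr (b - 2) * norm z \<le> \<delta> / 8 * b * J * R powr (g - 1)"
          by (simp only: mult.assoc)
      qed (use m A b in auto)
      then have 3: "(A * b * rad R z powr (b - 2) * norm z) powr m \<le> D2 * R powr ((g - 1) * m)"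
        unfolding D2_def powr_mult powr_powr by simp
      have "lam * (\<rho> powr - (?n + 2 * s) * ?int) \<le> D1 * R powr (g - 2 * s) + D2 * R powr ((g - 1) * m)"
        using 1 2 3 by linarith
      \<comment> \<open>The common factor is again \<open>R powr g * \<rho> powr (- 2 * s)\<close>;
        both remaining powers of \<open>R\<close> have negative exponents.\<close>
      also have "\<dots> = (D1 * R powr ((k - 1) * (2 * s)) + D2 * R powr (2 * s * k + (g - 1) * m - g)) * R powr (g - 2 * s * k)"
        unfolding distrib_right mult.assoc powr_add[symmetric] by (simp add: algebra_simps)
      also have "\<dots> \<le> lam * (1 / 4 * \<epsilon> * \<omega>) * R powr (g - 2 * s * k)"
        using E by (intro mult_right_mono) auto
      finally have "lam * (\<rho> powr - (?n + 2 * s) * ?int) \<le> lam * (1 / 4 * \<epsilon> * \<omega> * R powr (g - 2 * s * k))"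
        by (simp only: mult.assoc)
      then have "\<rho> powr - (?n + 2 * s) * ?int \<le> 1 / 4 * \<epsilon> * \<omega> * R powr (g - 2 * s * k)"
        using lam by (simp only: mult_le_cancel_left_pos)
      then have "\<rho> powr (?n + 2 * s) * (\<rho> powr - (?n + 2 * s) * ?int)
          \<le> \<rho> powr (?n + 2 * s) * (1 / 4 * \<epsilon> * \<omega> * R powr (g - 2 * s * k))"
        by (rule mult_left_mono) simp
      moreover have "\<rho> powr (?n + 2 * s) * (\<rho> powr - (?n + 2 * s) * ?int) = ?int"
        using \<rho> unfolding mult.assoc[symmetric] powr_add[symmetric] by simp
      moreover have "\<rho> powr (?n + 2 * s) * (1 / 4 * \<epsilon> * \<omega> * R powr (g - 2 * s * k))
          = 1 / 4 * (\<epsilon> * R powr g) * measure lebesgue (ball z \<rho>)"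
      proof -
        have "measure lebesgue (ball z \<rho>) = \<rho> powr ?n * \<omega>"
          using \<rho> content_ball_conv_unit_ball[of \<rho> z] by (simp add: \<omega>_def powr_realpow)
        moreover have "\<rho> powr (?n + 2 * s) * R powr (g - 2 * s * k) = R powr g * \<rho> powr ?n"
          unfolding \<rho>_def powr_powr powr_add[symmetric] by (simp add: algebra_simps)
        moreover have "\<rho> powr (?n + 2 * s) * (1 / 4 * \<epsilon> * \<omega> * R powr (g - 2 * s * k))
            = 1 / 4 * \<epsilon> * \<omega> * (\<rho> powr (?n + 2 * s) * R powr (g - 2 * s * k))"
          by (simp only: mult_ac)
        ultimately show ?thesis by (simp only: mult_ac)
      qed
      ultimately have int: "?int \<le> 1 / 4 * (\<epsilon> * R powr g) * measure lebesgue (ball z \<rho>)" by linarith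
      \<comment> \<open>The base level is raised from \<open>l\<close> to
        \<open>- (\<delta> / 2 * R powr g)\<close>. The right integrand is nonnegative by minimality
        and dominates the positive part because \<open>l\<close> is lower.\<close>
      have "(LINT y|lebesgue. indicator (annulus z \<rho>) y * max 0 (u y - - (\<delta> / 2 * R powr g))) \<le> ?int"
      proof (rule integral_mono)
        show "integrable lebesgue (\<lambda>y. indicator (annulus z \<rho>) y * max 0 (u y - - (\<delta> / 2 * R powr g)))"
          by (intro integrable_indicator_continuous continuous_intros continuous_u) auto
        show "integrable lebesgue (\<lambda>y. indicator (annulus z \<rho>) y * (u y + A * rad R y powr b - l))"
          using continuous_on_rad_powr[OF R(1), of UNIV 0 b]
          by (intro integrable_indicator_continuous continuous_on_diff continuous_on_add
              continuous_on_mult_left continuous_on_const continuous_u) auto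
        fix y
        have "max 0 (u y - - (\<delta> / 2 * R powr g)) \<le> u y + A * rad R y powr b - l"
        proof -
          have "0 \<le> A * rad R y powr b" using A by simp
          then show ?thesis using min[of y] l by linarith
        qed
        then show "indicator (annulus z \<rho>) y * max 0 (u y - - (\<delta> / 2 * R powr g))
            \<le> indicator (annulus z \<rho>) y * (u y + A * rad R y powr b - l)"
          by (intro mult_left_mono) auto
      qed
      \<comment> \<open>The origin lies within \<open>J * R\<close> of \<open>z\<close>, and
        \<open>u 0\<close> is a fixed number, bounded below by \<open>- M\<close>.\<close>
      then have "u 0 \<le> - (\<delta> / 2 * R powr g) + 8 * \<epsilon> * J\<^sup>2 * R powr g"
        using barrier[rule_format, of z "- (\<delta> / 2 * R powr g)" J 0] int J zJ unfolding \<rho>_def by simp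
      also have "8 * \<epsilon> * J\<^sup>2 * R powr g = \<delta> / 4 * R powr g"
        using J by (simp add: \<epsilon>_def)
      finally have "u 0 \<le> - (\<delta> / 4 * R powr g)" by simp
      moreover have "- M \<le> u 0" using growth[of 0] by simp
      moreover have "M < \<delta> / 4 * R powr g" using E \<delta> by (simp add: divide_less_eq mult.commute)
      ultimately show False by linarith
    qed
  qed
qed

end

section \<open>From bounds on large spheres to the limsup\<close>

theorem theorem1p3:
  fixes s m lam Lam \<gamma> M :: real
    and I :: "('a::euclidean_space \<Rightarrow> real) \<Rightarrow> 'a \<Rightarrow> real"
    and u :: "'a \<Rightarrow> real"
  assumes "1/2 < s" and "s < 1"
    and "m > 1"
    and "0 < lam" and "lam \<le> Lam"
    and "translation_invariant s I"
    and "positively_homogeneous s I"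
    and "elliptic s lam Lam I"
    and "viscosity_solution s I (\<lambda>x r p. norm p powr m) UNIV u"
    and "\<exists>x. u x \<noteq> 0"
    and "\<gamma> < 2 * s"
    and "\<forall>x. \<bar>u x\<bar> \<le> M * (1 + norm x) powr \<gamma>"
    and "Limsup at_infinity (\<lambda>x. ereal (\<bar>u x\<bar> / norm x powr \<gamma>)) > 0"
  shows "\<gamma> \<le> max 0 ((m - 2 * s) / (m - 1))"
proof (rule ccontr)
  assume "\<not> ?thesis"
  then have \<gamma>: "0 < \<gamma>" "(m - 2 * s) / (m - 1) < \<gamma>" by auto
  interpret viscosity_HJ s m lam Lam I u
    using assms by unfold_locales auto
  have growth: "\<bar>u y\<bar> \<le> M * (1 + norm y) powr \<gamma>" for y using assms by blast
  \<comment> \<open>Two-sided bounds on all large spheres are available for every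
    \<open>\<delta>\<close>, so the limsup cannot be positive.\<close>
  have "Limsup at_infinity (\<lambda>x. ereal (\<bar>u x\<bar> / norm x powr \<gamma>)) \<le> ereal \<delta>" if \<delta>: "0 < \<delta>" for \<delta>
  proof (rule Limsup_bounded)
    have "eventually (\<lambda>R. 0 < R \<and> (\<forall>x::'a. norm x = R \<longrightarrow> \<bar>u x\<bar> < \<delta> * R powr \<gamma>)) at_top"
      using eventually_upper_bound[OF growth \<gamma>(1) assms(11) \<gamma>(2) \<delta>]
        eventually_lower_bound[OF growth \<gamma>(1) assms(11) \<gamma>(2) \<delta>] eventually_gt_at_top[of 0]
    proof eventually_elim
      case (elim R)
      show ?case
      proof (intro conjI allI impI)
        fix x :: 'a assume "norm x = R"
        then have "u x < \<delta> * R powr \<gamma>" "- (\<delta> * R powr \<gamma>) < u x" using elim by blast+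
        then show "\<bar>u x\<bar> < \<delta> * R powr \<gamma>" by linarith
      qed (use elim in blast)
    qed
    then obtain T where T: "\<And>R. T \<le> R \<Longrightarrow> 0 < R \<and> (\<forall>x::'a. norm x = R \<longrightarrow> \<bar>u x\<bar> < \<delta> * R powr \<gamma>)"
      unfolding eventually_at_top_linorder by blast
    show "eventually (\<lambda>x. ereal (\<bar>u x\<bar> / norm x powr \<gamma>) \<le> ereal \<delta>) at_infinity"
      unfolding eventually_at_infinity
    proof (intro exI allI impI)
      fix x :: 'a assume "T \<le> norm x"
      from T[OF this] have "0 < norm x" "\<bar>u x\<bar> < \<delta> * norm x powr \<gamma>" by auto
      then show "ereal (\<bar>u x\<bar> / norm x powr \<gamma>) \<le> ereal \<delta>"
        by (simp add: divide_le_eq)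
    qed
  qed
  then have le: "Limsup at_infinity (\<lambda>x. ereal (\<bar>u x\<bar> / norm x powr \<gamma>)) \<le> 0 + ereal \<delta>"
    if "0 < \<delta>" for \<delta>
    using that by simp
  have "Limsup at_infinity (\<lambda>x. ereal (\<bar>u x\<bar> / norm x powr \<gamma>)) \<le> 0"
    by (rule ereal_le_epsilon2) (intro allI impI le)
  then show False using assms(13) leD by blast
qed

end
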